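(* For each $t\in J$, $\rho_t'$ is an Oxtoby–Ulam measure on $\hat D_t$, and the set of points of $\hat D_t$ that are regular for $\hat\mu_t$ under $\hat H_t$ has positive $\rho_t'$-measure.
   Context: Setup: $I=[-1,1]$, $J=(1,2]$, $f_t(x)=\min(t(x-1)+3,\,t(1-x)-1)$, $\mu_t$ its unique absolutely continuous invariant probability. $S$ is the circle of radius 2 with angular coordinate $y$; $D$ the disk of radius 2 with coordinates $(y,s)\in S\times[0,1]$ (from a smooth embedding of the mapping cylinder of $y\mapsto\cos y$), $(y,0)=y\in S$, $(y,1)=\cos y\in I\subset D$. $\Upsilon(y,s)=(y,2s)$ for $s\le1/2$, $(y,1)$ for $s\ge1/2$. An unwrapping is a continuous family of orientation-preserving near-homeomorphisms $\bar f_t\colon D\to D$ with $\bar f_t$ injective on $I$, $\bar f_t(I)\subset\{s\ge1/2\}$, $\Upsilon\circ\bar f_t|_I=f_t$, the second coordinate of $\bar f_t(y,s)$ equal to $s$ for $s\le1/2$; assume also $\bar f_t=\mathrm{id}$ on $S\times[0,3/4]$. $H_t=\Upsilon\circ\bar f_t$, $\hat D_t=\varprojlim(D,H_t)$ (a topological disk), natural extension $\hat H_t$, $\hat I_t=\varprojlim(I,f_t)\subset\hat D_t$, and $\hat\mu_t$ the $\hat H_t$-invariant measure with $(\pi_n)_*\hat\mu_t=\mu_t$ for all projections $\pi_n$. Let $A=S\times[0,\infty)$ and $\Psi_t\colon A\to\hat D_t\setminus\hat I_t$: for $s<1$, $\Psi_t(y,s)=\langle(y,s),(y,s/2),\dots\rangle$;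 for $s\ge1$, with $k=\lfloor s\rfloor$, $v=(s-k+1)/2$, $\Psi_t(y,s)=\langle z_0,z_1,\dots\rangle$, $z_{k-j}=H_t^{\,j}(y,v)$ ($1\le j\le k$), $z_k=(y,v)$, $z_{k+j}=(y,v/2^j)$. Let $m$ be the probability measure on $A$ with $dm=\frac1K\arctan(s)\,dy\,ds$ ($K$ a normalizing constant), and $\rho_t'$ the Borel probability measure on $\hat D_t$ given by $\rho_t'(E)=m(\Psi_t^{-1}(E\setminus\hat I_t))$ (so $\rho_t'(\hat I_t)=0$). A Borel probability measure on a manifold is Oxtoby–Ulam if it is non-atomic, positive on nonempty open sets, and gives zero measure to the manifold boundary. A point $x$ is regular for an invariant probability $\nu$ under $f$ if $\frac1n\sum_{i<n}\alpha(f^ix)\to\int\alpha\,d\nu$ for all continuous $\alpha$.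
   Formalization: The density arctan(s) dy ds has infinite total mass on S×[0,∞), so no normalizing constant K exists; m is instead taken with density (1/K)·1/(1+s²) dy ds, i.e. (1/K) dy d(arctan s), with K = π². *)

theory Defs
  imports "HOL-Complex_Analysis.Complex_Analysis" "HOL-Probability.Probability"
begin

text \<open>The plane R^2 is modelled by the type complex. D = closed disk of radius 2,
  I = [-1,1] on the real axis, S = boundary circle of radius 2.\<close>

definition Jset :: "real set" where "Jset = {1<..2}"

definition Dset :: "complex set" where "Dset = cball 0 2"

definition Iset :: "complex set" where "Iset = complex_of_real ` {-1..1}"

definition tent :: "real \<Rightarrow> real \<Rightarrow> real" where
  "tent t x = min (t * (x - 1) + 3) (t * (1 - x) - 1)"

definition is_acip :: "real \<Rightarrow> real measure \<Rightarrow> bool" where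
  "is_acip t nu \<longleftrightarrow> prob_space nu \<and> space nu = {-1..1}
     \<and> sets nu = sets (restrict_space borel {-1..1})
     \<and> absolutely_continuous (restrict_space lborel {-1..1}) nu
     \<and> tent t \<in> measurable nu nu \<and> distr nu nu (tent t) = nu"

text \<open>Coordinates (y,s) on D: Phi y s, from an embedding of the mapping cylinder of y \<mapsto> cos y.\<close>
definition is_cyl_coords :: "(real \<Rightarrow> real \<Rightarrow> complex) \<Rightarrow> bool" where
  "is_cyl_coords Phi \<longleftrightarrow>
     continuous_on (UNIV \<times> {0..1}) (\<lambda>(y, s). Phi y s)
   \<and> (\<lambda>(y, s). Phi y s) ` (UNIV \<times> {0..1}) = Dset
   \<and> (\<forall>y. Phi y 0 = 2 * cis y)
   \<and> (\<forall>y. Phi y 1 = complex_of_real (cos y))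
   \<and> (\<forall>y y' s s'. s \<in> {0..1} \<longrightarrow> s' \<in> {0..1} \<longrightarrow>
        (Phi y s = Phi y' s' \<longleftrightarrow>
          s = s' \<and> (if s = 1 then cos y = cos y' else (\<exists>k::int. y' = y + 2 * pi * of_int k))))"

definition Ups :: "(real \<Rightarrow> real \<Rightarrow> complex) \<Rightarrow> complex \<Rightarrow> complex" where
  "Ups Phi p = (SOME q. \<exists>y s. s \<in> {0..1} \<and> p = Phi y s \<and> q = Phi y (min (2 * s) 1))"

text \<open>orientation preserving homeomorphism of D onto itself (boundary circle has degree 1)\<close>
definition op_homeo_D :: "(complex \<Rightarrow> complex) \<Rightarrow> bool" where
  "op_homeo_D h \<longleftrightarrow> (\<exists>g. homeomorphism Dset Dset h g)
     \<and> winding_number (h \<circ> circlepath 0 2) 0 = 1"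

definition op_near_homeo_D :: "(complex \<Rightarrow> complex) \<Rightarrow> bool" where
  "op_near_homeo_D f \<longleftrightarrow> f ` Dset \<subseteq> Dset \<and>
     (\<exists>h :: nat \<Rightarrow> complex \<Rightarrow> complex. (\<forall>k. op_homeo_D (h k))
        \<and> uniform_limit Dset h f sequentially)"

definition is_unwrapping :: "(real \<Rightarrow> real \<Rightarrow> complex) \<Rightarrow> (real \<Rightarrow> complex \<Rightarrow> complex) \<Rightarrow> bool" where
  "is_unwrapping Phi fb \<longleftrightarrow>
     continuous_on (Jset \<times> Dset) (\<lambda>(t, p). fb t p)
   \<and> (\<forall>t\<in>Jset.
        op_near_homeo_D (fb t)
      \<and> inj_on (fb t) Iset
      \<and> fb t ` Iset \<subseteq> (\<lambda>(y, s). Phi y s) ` (UNIV \<times> {1/2..1})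
      \<and> (\<forall>x\<in>{-1..1}. Ups Phi (fb t (complex_of_real x)) = complex_of_real (tent t x))
      \<and> (\<forall>y. \<forall>s\<in>{0..1/2}. \<exists>y'. fb t (Phi y s) = Phi y' s)
      \<and> (\<forall>y. \<forall>s\<in>{0..3/4}. fb t (Phi y s) = Phi y s))"

definition hatD :: "(complex \<Rightarrow> complex) \<Rightarrow> (nat \<Rightarrow> complex) set" where
  "hatD H = {z. \<forall>n. z n \<in> Dset \<and> H (z (Suc n)) = z n}"

definition hatI :: "(complex \<Rightarrow> complex) \<Rightarrow> (nat \<Rightarrow> complex) set" where
  "hatI H = {z \<in> hatD H. \<forall>n. z n \<in> Iset}"

definition hatH :: "(complex \<Rightarrow> complex) \<Rightarrow> (nat \<Rightarrow> complex) \<Rightarrow> (nat \<Rightarrow> complex)" where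
  "hatH H z = (\<lambda>n. case n of 0 \<Rightarrow> H (z 0) | Suc m \<Rightarrow> z m)"

definition Psi :: "(real \<Rightarrow> real \<Rightarrow> complex) \<Rightarrow> (complex \<Rightarrow> complex) \<Rightarrow> real \<times> real \<Rightarrow> (nat \<Rightarrow> complex)" where
  "Psi Phi H ys = (\<lambda>n. let y = fst ys; s = snd ys in
     if s < 1 then Phi y (s / 2 ^ n)
     else (let k = nat \<lfloor>s\<rfloor>; v = (s - real k + 1) / 2 in
           if n \<le> k then (H ^^ (k - n)) (Phi y v) else Phi y (v / 2 ^ (n - k))))"

text \<open>A = S x [0,oo), with S parametrised by y in [0, 2 pi)\<close>
definition Aset :: "(real \<times> real) set" where "Aset = {0..<2 * pi} \<times> {0..}"

definition m_dens :: "real \<times> real \<Rightarrow> ennreal" where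
  "m_dens ys = ennreal (1 / (1 + (snd ys)\<^sup>2))"

definition m_meas :: "(real \<times> real) measure" where
  "m_meas = density (restrict_space lborel Aset)
     (\<lambda>ys. m_dens ys / (\<integral>\<^sup>+ u. m_dens u \<partial>(restrict_space lborel Aset)))"

definition rho' :: "(real \<Rightarrow> real \<Rightarrow> complex) \<Rightarrow> (complex \<Rightarrow> complex) \<Rightarrow> (nat \<Rightarrow> complex) measure" where
  "rho' Phi H = measure_of (hatD H) (sets (restrict_space borel (hatD H)))
     (\<lambda>E. emeasure m_meas (Psi Phi H -` (E - hatI H) \<inter> space m_meas))"

definition mfd_boundary2 :: "'a::topological_space set \<Rightarrow> 'a set" where
  "mfd_boundary2 X = {x \<in> X. \<not> (\<exists>U (V :: complex set). openin (top_of_set X) U \<and> x \<in> U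
                                  \<and> open V \<and> U homeomorphic V)}"

definition oxtoby_ulam :: "'a::topological_space set \<Rightarrow> 'a measure \<Rightarrow> bool" where
  "oxtoby_ulam X nu \<longleftrightarrow> prob_space nu \<and> space nu = X
     \<and> sets nu = sets (restrict_space borel X)
     \<and> (\<forall>x\<in>X. emeasure nu {x} = 0)
     \<and> (\<forall>U. openin (top_of_set X) U \<and> U \<noteq> {} \<longrightarrow> emeasure nu U > 0)
     \<and> emeasure nu (mfd_boundary2 X) = 0"

definition regular_pt :: "'a::topological_space set \<Rightarrow> ('a \<Rightarrow> 'a) \<Rightarrow> 'a measure \<Rightarrow> 'a \<Rightarrow> bool" where
  "regular_pt X T nu x \<longleftrightarrow> x \<in> X \<and> (\<forall>\<alpha> :: 'a \<Rightarrow> real. continuous_on X \<alpha> \<longrightarrow>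
     (\<lambda>n. (\<Sum>i<n. \<alpha> ((T ^^ i) x)) / real n) \<longlonglongrightarrow> (\<integral>u. \<alpha> u \<partial>nu))"

definition is_hat_mu :: "(complex \<Rightarrow> complex) \<Rightarrow> real measure \<Rightarrow> (nat \<Rightarrow> complex) measure \<Rightarrow> bool" where
  "is_hat_mu H mu hmu \<longleftrightarrow> space hmu = hatD H
     \<and> sets hmu = sets (restrict_space borel (hatD H))
     \<and> hatH H \<in> measurable hmu hmu \<and> distr hmu hmu (hatH H) = hmu
     \<and> (\<forall>n. distr hmu borel (\<lambda>z. z n) = distr mu borel complex_of_real)"

end

theory Submission
  imports Defs
begin

text \<open>Write H for the map obtained from the unwrapping. Levels double under H until they reach 1, so a
  thread that is not contained in I is determined by its first entry z k outside I, and its further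
  entries are obtained by halving the level. Hence \<Psi> is a bijection onto the complement of the inverse
  limit of I, each set of threads with 0 < level (z N) < 1 is open and homeomorphic to an open subset of
  the plane, and every thread in I agrees with a thread outside I on arbitrarily many coordinates.

  For y arbitrary and 1 \<le> s \<le> 3/2 the zeroth entry of \<Psi>(y, s) is cos y, so the orbit of \<Psi>(y, s)
  eventually shadows the orbit of cos y under the tent map in every coordinate. It remains to know that
  Lebesgue-positively many points of I are generic for \<mu>. This follows from Birkhoff's theorem once \<mu> is
  ergodic, and the tent map is ergodic even for Lebesgue measure: its n-th iterate has O(t^n) affine
  branches, all of slope t^n in absolute value, so points with uniformly long images of branches
  around them infinitely often have almost full measure. A covering argument then shows that an invariant
  set of positive measure contains an interval up to a null set, and by expansion a neighbourhood of the
  turning point; two disjoint such sets cannot coexist.\<close>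

section \<open>Lebesgue ergodicity of the tent map\<close>

text \<open>Nothing but absolute continuity links \<open>mu\<close> to Lebesgue measure. So
  ergodicity is proved for Lebesgue measure and then inherited by \<open>mu\<close>; in return, a
  set of full \<open>mu\<close>-measure is only known to be non-negligible, which is just what a
  positive \<open>rho'\<close>-measure requires.

  For t < 2 the branches of the iterates need not be full, and their images can be arbitrarily
  short. The branch count repairs this: the points within \<delta> / t^n of a breakpoint have
  measure at most a fixed multiple of \<delta>, uniformly along a sequence of times n, and \<delta>
  may be chosen small against the measure of the given invariant set. Around the remaining points
  the iterate is exactly affine, so proportions of measure are transported without distortion.

  On the inverse limit the recurring obstacle is measurability, since \<open>emeasure\<close> is 0
  on sets outside the sigma-algebra. The manifold boundary is therefore enclosed in a relatively
  closed set, and regularity is reduced to countably many test functions.\<close>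

definition turning_pt :: "real \<Rightarrow> real" where "turning_pt t = 1 - 2 / t"

text \<open>The two affine pieces have slopes t and -t and meet at 1 - 2/t with common value
  1.\<close>

lemma tent_abs:
  assumes "t > 0"
  shows "tent t x = 1 - t * \<bar>x - turning_pt t\<bar>"
proof -
  have 1: "t * (x - 1) + 3 = 1 + t * (x - turning_pt t)" "t * (1 - x) - 1 = 1 - t * (x - turning_pt t)"
    using assms by (simp_all add: turning_pt_def field_simps)
  show ?thesis
    unfolding tent_def 1 using assms
    using mult_nonneg_nonneg[of t "x - turning_pt t"] mult_nonneg_nonneg[of t "turning_pt t - x"]
    by (cases "x \<ge> turning_pt t") (auto simp: algebra_simps)
qed

lemma Jset_gt1: "t \<in> Jset \<Longrightarrow> t > 1" and Jset_le2: "t \<in> Jset \<Longrightarrow> t \<le> 2"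
  by (auto simp: Jset_def)

lemma tent_in_I: "t \<in> Jset \<Longrightarrow> x \<in> {-1..1} \<Longrightarrow> tent t x \<in> {-1..1}"
proof -
  assume t: "t \<in> Jset" and x: "x \<in> {-1..1}"
  have "-1 \<le> t * (x - 1) + 3"
    using mult_left_mono[of "-2" "x - 1" t] t x by (auto simp: Jset_def)
  moreover have "-1 \<le> t * (1 - x) - 1"
    using t x by (auto simp: Jset_def)
  moreover have "tent t x \<le> 1"
    using tent_abs[of t x] t by (auto simp: Jset_def)
  ultimately show ?thesis by (auto simp: tent_def)
qed

lemma tent_iter_in_I: "t \<in> Jset \<Longrightarrow> x \<in> {-1..1} \<Longrightarrow> (tent t ^^ n) x \<in> {-1..1}"
proof (induction n)
  case (Suc n) then show ?case using tent_in_I[of t "(tent t ^^ n) x"] by simp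
qed simp

lemma continuous_on_tent: "continuous_on X (tent t)"
  unfolding tent_def[abs_def] by (intro continuous_intros)

lemma continuous_on_tent_iter: "continuous_on X (tent t ^^ n)"
proof (induction n)
  case (Suc n)
  then show ?case
    using continuous_on_compose[OF Suc continuous_on_tent] by (simp add: o_def)
qed (simp add: id_def)

text \<open>Each application multiplies the slope by t or -t as long as the current image stays on
  one side of the turning point. Only interior points have to avoid it, so the ends of the interval
  may be breakpoints.\<close>

lemma tent_iter_affine:
  assumes t: "t > 0" and ab: "a \<le> b"
    and free: "\<And>i z. i < n \<Longrightarrow> a < z \<Longrightarrow> z < b \<Longrightarrow> (tent t ^^ i) z \<noteq> turning_pt t"
  shows "\<exists>\<sigma>. \<bar>\<sigma>\<bar> = 1 \<and> (\<forall>z\<in>{a..b}. (tent t ^^ n) z = (tent t ^^ n) a + \<sigma> * t ^ n * (z - a))"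
  using free
proof (induction n)
  case 0
  show ?case by (intro exI[of _ 1]) auto
next
  case (Suc n)
  have "\<exists>\<sigma>. \<bar>\<sigma>\<bar> = 1 \<and> (\<forall>z\<in>{a..b}. (tent t ^^ n) z = (tent t ^^ n) a + \<sigma> * t ^ n * (z - a))"
    by (rule Suc.IH) (rule Suc.prems, auto)
  then obtain \<sigma> where \<sigma>: "\<bar>\<sigma>\<bar> = 1" 
    and aff: "\<And>z. z \<in> {a..b} \<Longrightarrow> (tent t ^^ n) z = (tent t ^^ n) a + \<sigma> * t ^ n * (z - a)"
    by blast
  define g where "g = tent t ^^ n"
  define c where "c = turning_pt t"
  define s where "s = \<sigma> * t ^ n"
  have s0: "s \<noteq> 0" using \<sigma> t by (auto simp: s_def)
  have g: "g z = g a + s * (z - a)" if "z \<in> {a..b}" for z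
    using aff[OF that] by (simp add: g_def s_def)
  have gs: "tent t ((tent t ^^ n) z) = 1 - t * \<bar>g z - c\<bar>" for z
    using tent_abs[OF t] by (simp add: g_def c_def)
  have gc: "g z \<noteq> c" if "a < z" "z < b" for z
    using Suc.prems[of n z] that by (auto simp: g_def c_def)
  \<comment> \<open>An image meeting both sides strictly would, by the intermediate value theorem,
    hit the turning point strictly between two points of the interval.\<close>
  have "(\<forall>z\<in>{a..b}. g z \<ge> c) \<or> (\<forall>z\<in>{a..b}. g z \<le> c)"
  proof (rule ccontr)
    assume "\<not> ?thesis"
    then obtain u v where uv: "u \<in> {a..b}" "v \<in> {a..b}" "g u < c" "g v > c" by (auto simp: not_le)
    have cont: "continuous_on X g" for X unfolding g_def by (rule continuous_on_tent_iter)
    have "\<exists>z\<in>closed_segment u v. g z = c"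
      using IVT'[of g u c v] IVT2'[of g u c v] cont uv
      by (cases "u \<le> v") (auto simp: closed_segment_eq_real_ivl)
    then obtain z where z: "z \<in> closed_segment u v" "g z = c" by blast
    then have "z \<noteq> u" "z \<noteq> v" using uv by auto
    then have "a < z" "z < b" using z uv by (auto simp: closed_segment_eq_real_ivl split: if_splits)
    then show False using gc z by blast
  qed
  then show ?case
  proof
    assume A: "\<forall>z\<in>{a..b}. g z \<ge> c"
    show ?thesis
    proof (intro exI[of _ "-\<sigma>"] conjI ballI)
      fix z assume z: "z \<in> {a..b}"
      have "g z \<ge> c" "g a \<ge> c" using A z ab by auto
      then have "\<bar>g z - c\<bar> = \<bar>g a - c\<bar> + s * (z - a)" using g[OF z] by linarith
      then have "(tent t ^^ Suc n) z = 1 - t * (\<bar>g a - c\<bar> + s * (z - a))" by (simp add: gs)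
      then show "(tent t ^^ Suc n) z = (tent t ^^ Suc n) a + - \<sigma> * t ^ Suc n * (z - a)"
        by (simp add: gs s_def algebra_simps)
    qed (use \<sigma> in auto)
  next
    assume A: "\<forall>z\<in>{a..b}. g z \<le> c"
    show ?thesis
    proof (intro exI[of _ "\<sigma>"] conjI ballI)
      fix z assume z: "z \<in> {a..b}"
      have "g z \<le> c" "g a \<le> c" using A z ab by auto
      then have "\<bar>g z - c\<bar> = \<bar>g a - c\<bar> - s * (z - a)" using g[OF z] by linarith
      then have "(tent t ^^ Suc n) z = 1 - t * (\<bar>g a - c\<bar> - s * (z - a))" by (simp add: gs)
      then show "(tent t ^^ Suc n) z = (tent t ^^ Suc n) a + \<sigma> * t ^ Suc n * (z - a)"
        by (simp add: gs s_def algebra_simps)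
    qed (use \<sigma> in auto)
  qed
qed

text \<open>Each gap between neighbours in E is charged either to its length, at least \<eta>, or to
  an element of D inside it. The first kind occurs at most (b - a) / \<eta> times, the second at
  most \<open>card D\<close> times.\<close>

lemma card_le_separated:
  fixes D E :: "real set"
  assumes D: "finite D" and E: "finite E" "E \<subseteq> {a..b}" and ab: "a \<le> b" and \<eta>: "\<eta> > 0"
    and sep: "\<And>e e'. e \<in> E \<Longrightarrow> e' \<in> E \<Longrightarrow> e < e' \<Longrightarrow> e' - e \<ge> \<eta> \<or> (\<exists>d\<in>D. e < d \<and> d \<le> e')"
  shows "real (card E) \<le> card D + (b - a) / \<eta> + 1"
proof -
  \<comment> \<open>Adding points from left to right, the right-hand side with D cut off at
    \<open>Max E\<close> grows by at least 1 at every new maximum.\<close>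
  have "E \<noteq> {} \<longrightarrow> real (card E) \<le> card (D \<inter> {..Max E}) + (Max E - a) / \<eta> + 1"
    using E sep
  proof (induction E rule: finite_linorder_max_induct)
    case (insert e' E)
    show ?case
    proof (cases "E = {}")
      case True
      then show ?thesis using insert.prems \<eta> by auto
    next
      case False
      define e where "e = Max E"
      have e: "e \<in> E" "e < e'" using insert False by (auto simp: e_def)
      have M: "Max (insert e' E) = e'" using insert False e by (subst Max_insert) (auto simp: e_def)
      have c: "card (insert e' E) = Suc (card E)" using insert by (subst card_insert_disjoint) auto
      have IH: "real (card E) \<le> card (D \<inter> {..e}) + (e - a) / \<eta> + 1"
        using insert.IH insert.prems False unfolding e_def by auto
      have sub: "card (D \<inter> {..e}) \<le> card (D \<inter> {..e'})"
        using e D by (intro card_mono) auto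
      have d: "(e - a) / \<eta> \<le> (e' - a) / \<eta>" using e \<eta> by (intro divide_right_mono) auto
      from insert.prems(2)[of e e'] e consider "e' - e \<ge> \<eta>" | x where "x \<in> D" "e < x" "x \<le> e'" by auto
      then show ?thesis
      proof cases
        case 1
        then have "(e - a + \<eta>) / \<eta> \<le> (e' - a) / \<eta>" using \<eta> by (intro divide_right_mono) auto
          then have "(e - a) / \<eta> + 1 \<le> (e' - a) / \<eta>" using \<eta> by (simp add: add_divide_distrib)
        then show ?thesis using IH sub unfolding M c by simp
      next
        case 2
        have "card (insert x (D \<inter> {..e})) \<le> card (D \<inter> {..e'})"
          using 2 D e by (intro card_mono) auto
        then have "card (D \<inter> {..e}) + 1 \<le> card (D \<inter> {..e'})" using 2 D by auto
        then show ?thesis using IH d unfolding M c by simp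
      qed
    qed
  qed simp
  moreover have "(Max E - a) / \<eta> \<le> (b - a) / \<eta>" if "E \<noteq> {}"
    using Max_in[OF E(1) that] E \<eta> by (intro divide_right_mono) auto
  moreover have "card (D \<inter> {..Max E}) \<le> card D" using D by (intro card_mono) auto
  ultimately show ?thesis using ab \<eta> by (cases "E = {}") auto
qed

section \<open>Breakpoints of the iterates and their number\<close>

definition crit :: "real \<Rightarrow> nat \<Rightarrow> real set" where
  "crit t n = {x \<in> {-1..1}. \<exists>i<n. (tent t ^^ i) x = turning_pt t}"

lemma finite_tent_vimage: "t > 0 \<Longrightarrow> finite {x. tent t x = y}"
  by (rule finite_subset[of _ "{turning_pt t + (1 - y) / t, turning_pt t - (1 - y) / t}"])
    (auto simp: tent_abs field_simps abs_if split: if_splits)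

lemma finite_tent_iter_vimage: "t > 0 \<Longrightarrow> finite {x. (tent t ^^ n) x = y}"
proof (induction n)
  case (Suc n)
  have "{x. (tent t ^^ Suc n) x = y} = (\<Union>z\<in>{z. (tent t ^^ n) z = y}. {x. tent t x = z})"
    by (auto simp: funpow_Suc_right simp del: funpow.simps)
  then show ?case using Suc finite_tent_vimage by simp
qed simp

lemma finite_crit: assumes "t > 0" shows "finite (crit t n)"
proof (rule finite_subset)
  show "crit t n \<subseteq> (\<Union>i<n. {x. (tent t ^^ i) x = turning_pt t})" by (auto simp: crit_def)
qed (use finite_tent_iter_vimage[OF assms] in auto)

text \<open>Including the endpoints of I makes one condition do two jobs: a ball that stays away
  from \<open>brk t n\<close> lies in I and inside a single affine branch.\<close>

definition brk :: "real \<Rightarrow> nat \<Rightarrow> real set" where "brk t n = {-1, 1} \<union> crit t n"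

lemma finite_brk: "t > 0 \<Longrightarrow> finite (brk t n)"
  by (simp add: brk_def finite_crit)

lemma finite_set_min_gap:
  fixes T :: "real set"
  assumes "finite T"
  obtains \<delta> where "\<delta> > 0" "\<And>x y. x \<in> T \<Longrightarrow> y \<in> T \<Longrightarrow> x \<noteq> y \<Longrightarrow> \<bar>x - y\<bar> \<ge> \<delta>"
proof -
  \<comment> \<open>The extra element 1 keeps the minimum defined when T has at most one
    point.\<close>
  define G where "G = insert 1 ((\<lambda>(x, y). \<bar>x - y\<bar>) ` {(x, y). x \<in> T \<and> y \<in> T \<and> x \<noteq> y})"
  have "finite {(x, y). x \<in> T \<and> y \<in> T \<and> x \<noteq> y}"
    by (rule finite_subset[of _ "T \<times> T"]) (use assms in auto)
  then have G: "finite G" "G \<noteq> {}" by (auto simp: G_def)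
  show ?thesis
  proof
    show "Min G > 0" using G by (subst Min_gr_iff) (auto simp: G_def)
    show "\<bar>x - y\<bar> \<ge> Min G" if "x \<in> T" "y \<in> T" "x \<noteq> y" for x y
      using that G by (intro Min_le) (auto simp: G_def)
  qed
qed

text \<open>An affine branch of the n-th iterate of length l carries at most 1 + l t^n / \<delta> new
  breakpoints, where \<delta> is the smallest gap in crit t k. Once t^k exceeds 2 the resulting recursion
  bounds the number of breakpoints by a multiple of t^n.\<close>
lemma card_brk_step:
  assumes t: "t \<in> Jset" and \<delta>: "\<delta> > 0" 
    "\<And>x y. x \<in> crit t k \<Longrightarrow> y \<in> crit t k \<Longrightarrow> x \<noteq> y \<Longrightarrow> \<bar>x - y\<bar> \<ge> \<delta>"
  shows "real (card (brk t (n + k))) \<le> 2 * card (brk t n) + 2 * t ^ n / \<delta> + 1"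
proof -
  have t0: "t > 0" using t by (auto simp: Jset_def)
  define E where "E = {x \<in> {-1..1}. (tent t ^^ n) x \<in> crit t k}"
  have finE: "finite E"
  proof (rule finite_subset)
    show "E \<subseteq> (\<Union>y\<in>crit t k. {x. (tent t ^^ n) x = y})" by (auto simp: E_def)
  qed (use finite_crit[OF t0] finite_tent_iter_vimage[OF t0] in auto)
  have "brk t (n + k) \<subseteq> brk t n \<union> E"
  proof
    fix x assume "x \<in> brk t (n + k)"
    then consider "x \<in> {-1, 1}" | "x \<in> crit t (n + k)" by (auto simp: brk_def)
    then show "x \<in> brk t n \<union> E"
    proof cases
      case 2
      then obtain i where i: "x \<in> {-1..1}" "i < n + k" "(tent t ^^ i) x = turning_pt t" by (auto simp: crit_def)
      show ?thesis
      proof (cases "i < n")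
        case True 
        then have "x \<in> crit t n" using i unfolding crit_def by blast
        then show ?thesis by (simp add: brk_def)
      next
        case False
        then have "tent t ^^ i = (tent t ^^ (i - n)) \<circ> (tent t ^^ n)"
          using funpow_add[of "i - n" n "tent t"] by simp
        then have "(tent t ^^ (i - n)) ((tent t ^^ n) x) = turning_pt t"
          using i(3) by (metis comp_apply)
        moreover have "i - n < k" using False i by auto
        ultimately have "(tent t ^^ n) x \<in> crit t k"
          unfolding crit_def using tent_iter_in_I[OF t i(1), of n] by blast
        then show ?thesis using i by (simp add: E_def)
      qed
    qed (auto simp: brk_def)
  qed
  then have "card (brk t (n + k)) \<le> card (brk t n \<union> E)"
    using finE finite_brk[OF t0] by (intro card_mono) auto
  also have "\<dots> \<le> card (brk t n) + card E" by (rule card_Un_le)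
  finally have 1: "real (card (brk t (n + k))) \<le> card (brk t n) + card E" by linarith
  have "real (card E) \<le> card (brk t n) + (1 - (-1)) / (\<delta> / t ^ n) + 1"
  proof (rule card_le_separated)
    fix e e' :: real assume e: "e \<in> E" "e' \<in> E" "e < e'"
    show "\<delta> / t ^ n \<le> e' - e \<or> (\<exists>d\<in>brk t n. e < d \<and> d \<le> e')"
    proof (rule disjCI)
      assume no: "\<not> (\<exists>d\<in>brk t n. e < d \<and> d \<le> e')"
      have "\<exists>\<sigma>. \<bar>\<sigma>\<bar> = 1 \<and> (\<forall>z\<in>{e..e'}. (tent t ^^ n) z = (tent t ^^ n) e + \<sigma> * t ^ n * (z - e))"
      proof (rule tent_iter_affine[OF t0])
        fix i z assume "i < n" "e < z" "z < e'"
        moreover from this have "z \<in> {-1..1}" using e by (simp add: E_def)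
        moreover have "z \<notin> brk t n" using \<open>e < z\<close> \<open>z < e'\<close> no by (meson less_imp_le)
        ultimately show "(tent t ^^ i) z \<noteq> turning_pt t"
          unfolding brk_def crit_def by blast
      qed (use e in auto)
      then obtain \<sigma> where "\<bar>\<sigma>\<bar> = 1" "(tent t ^^ n) e' = (tent t ^^ n) e + \<sigma> * t ^ n * (e' - e)" 
        using e(3) by (meson atLeastAtMost_iff less_imp_le order_refl)
      then have eq: "\<bar>(tent t ^^ n) e' - (tent t ^^ n) e\<bar> = t ^ n * (e' - e)"
        using t0 e by (simp add: abs_mult)
      have "t ^ n * (e' - e) > 0" using t0 e by simp
      then have "(tent t ^^ n) e' \<noteq> (tent t ^^ n) e" using eq by linarith
      moreover have "(tent t ^^ n) e' \<in> crit t k" "(tent t ^^ n) e \<in> crit t k" 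
        using e by (simp_all only: E_def mem_Collect_eq)
      ultimately have "\<bar>(tent t ^^ n) e' - (tent t ^^ n) e\<bar> \<ge> \<delta>"
        by (intro \<delta>(2))
      then have "\<delta> \<le> (e' - e) * t ^ n" unfolding eq by (simp add: mult.commute)
      then show "\<delta> / t ^ n \<le> e' - e" using t0 by (subst pos_divide_le_eq) auto
    qed
  next
    show "0 < \<delta> / t ^ n" using \<delta>(1) t0 by simp
    show "E \<subseteq> {-1..1}" unfolding E_def by blast
  qed (use finE finite_brk[OF t0] in simp_all)
  with 1 show ?thesis by simp
qed

lemma card_brk_bound:
  assumes t: "t \<in> Jset"
  obtains M k where "M > 0" "k > 0" "\<And>j. real (card (brk t (k * j))) \<le> M * t ^ (k * j)"
proof -
  have t1: "t > 1" using t by (rule Jset_gt1)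
  obtain k where k: "t ^ k > 2" using real_arch_pow[OF t1] by blast
  then have "k > 0" by (cases k) auto
  obtain \<delta> where \<delta>: "\<delta> > 0" "\<And>x y. x \<in> crit t k \<Longrightarrow> y \<in> crit t k \<Longrightarrow> x \<noteq> y \<Longrightarrow> \<bar>x - y\<bar> \<ge> \<delta>"
    by (rule finite_set_min_gap[OF finite_crit[of t k]]) (use t1 in \<open>simp, blast\<close>)
  define q where "q = t ^ k"
  define L where "L = 2 / \<delta> + 1"
  \<comment> \<open>The recursion closes as soon as 2 M + L \<le> M q, that is M \<ge> L / (q - 2);
    the other entry of the maximum covers j = 0. The summand 1 in L absorbs the constant term of the
    recursion, since t^(k j) \<ge> 1.\<close>
  define M where "M = max (real (card (brk t 0))) (L / (q - 2))"
  have q: "q > 2" using k by (simp add: q_def)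
  have L0: "L > 0" using \<delta> by (simp add: L_def add_pos_pos)
  have M0: "M > 0" using q L0 by (auto simp: M_def less_max_iff_disj)
  have LM: "L \<le> M * (q - 2)"
    using q pos_divide_le_eq[of "q - 2" L M] by (simp add: M_def)
  have "real (card (brk t (k * j))) \<le> M * t ^ (k * j)" for j
  proof (induction j)
    case (Suc j)
    have p: "t ^ (k * j) \<ge> 1" using t1 by (intro one_le_power) auto
    have "real (card (brk t (k * Suc j))) \<le> 2 * card (brk t (k * j)) + 2 * t ^ (k * j) / \<delta> + 1"
      using card_brk_step[OF t \<delta>, where n = "k * j"] by (simp add: add.commute)
    also have "\<dots> \<le> 2 * (M * t ^ (k * j)) + 2 * t ^ (k * j) / \<delta> + t ^ (k * j)"
      using Suc p by linarith
    also have "\<dots> = (2 * M + L) * t ^ (k * j)" by (simp add: L_def algebra_simps)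
    also have "\<dots> \<le> (M * q) * t ^ (k * j)"
      using LM p by (intro mult_right_mono) (auto simp: algebra_simps)
    also have "\<dots> = M * t ^ (k * Suc j)" by (simp add: q_def power_add algebra_simps)
    finally show ?case .
  qed (simp add: M_def)
  with M0 \<open>k > 0\<close> show ?thesis by (rule that)
qed

section \<open>Points near breakpoints and the covering argument\<close>

definition near_brk :: "real \<Rightarrow> nat \<Rightarrow> real \<Rightarrow> real set" where
  "near_brk t n r = {x \<in> {-1..1}. \<exists>d\<in>brk t n. \<bar>x - d\<bar> < r}"

lemma near_brk_eq: "near_brk t n r = {-1..1} \<inter> (\<Union>d\<in>brk t n. {d - r<..<d + r})"
  unfolding near_brk_def by (auto simp: abs_less_iff algebra_simps)

lemma lmeasurable_near_brk [simp]: "near_brk t n r \<in> lmeasurable"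
proof -
  have "open (\<Union>d\<in>brk t n. {d - r<..<d + r})" by auto
  then show ?thesis 
    unfolding near_brk_eq by (intro fmeasurable_Int_fmeasurable sets_completionI_sets) auto
qed

lemma measure_near_brk:
  fixes r :: real
  assumes "t > 0" "r > 0"
  shows "measure lebesgue (near_brk t n r) \<le> real (card (brk t n)) * (2 * r)"
proof -
  have "measure lebesgue (near_brk t n r) \<le> measure lebesgue (\<Union>d\<in>brk t n. {d - r<..<d + r})"
    unfolding near_brk_eq using finite_brk[OF assms(1)]
    by (intro measure_mono_fmeasurable fmeasurable.finite_UN) auto
  also have "\<dots> \<le> (\<Sum>d\<in>brk t n. measure lebesgue {d - r<..<d + r})"
    using finite_brk[OF assms(1)] by (intro measure_UNION_le) auto
  also have "\<dots> = real (card (brk t n)) * (2 * r)" using assms by simp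
  finally show ?thesis .
qed

lemma emeasure_lebesgue_affine_vimage:
  fixes s x y :: real
  assumes "s \<noteq> 0"
  shows "emeasure lebesgue {z. y + s * (z - x) \<in> S} = ennreal (1 / \<bar>s\<bar>) * emeasure lebesgue S"
proof -
  have "{z. y + s * (z - x) \<in> S} = (\<lambda>w. (1 / s) *\<^sub>R w + (x - y / s)) ` S"
  proof (intro subset_antisym subsetI)
    fix z assume "z \<in> {z. y + s * (z - x) \<in> S}"
    then show "z \<in> (\<lambda>w. (1 / s) *\<^sub>R w + (x - y / s)) ` S"
      using assms by (intro image_eqI[of _ _ "y + s * (z - x)"]) (auto simp: field_simps)
  qed (use assms in \<open>auto simp: field_simps\<close>)
  then show ?thesis using emeasure_lebesgue_affine[of "1 / s" "x - y / s" S] by simp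
qed

text \<open>If A filled no interval up to a null set, every interval of radius \<delta> in I would
  lose a uniform amount \<kappa> to the complement. Pulled back along affine branches, this loss
  becomes a fixed proportion of arbitrarily small balls around most points of A. Disjoint balls of
  this kind nearly exhaust those points inside an open set barely larger than A, which is
  impossible.\<close>

lemma invariant_contains_interval:
  assumes t: "t \<in> Jset" and A: "A \<in> sets lebesgue" "A \<subseteq> {-1..1}" and inv: "tent t ` A \<subseteq> A"
    and pos: "\<not> negligible A"
  obtains a b where "-1 \<le> a" "a < b" "b \<le> 1" "negligible ({a..b} - A)"
proof (rule ccontr)
  assume "\<not> thesis"
  then have no: "\<not> negligible ({a..b} - A)" if "-1 \<le> a" "a < b" "b \<le> 1" for a b
    using that \<open>\<And>b a. \<lbrakk>- 1 \<le> a; a < b; b \<le> 1; negligible ({a..b} - A)\<rbrakk> \<Longrightarrow> thesis\<close> by blast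
  let ?\<mu> = "measure lebesgue"
  have t0: "t > 0" and t1: "t > 1" using t by (auto simp: Jset_def)
  have Am: "A \<in> lmeasurable" 
    by (rule bounded_set_imp_lmeasurable[OF bounded_subset[OF bounded_closed_interval A(2)] A(1)])
  define \<alpha> where "\<alpha> = ?\<mu> A"
  have \<alpha>: "\<alpha> > 0" using pos Am negligible_iff_measure0[OF Am] measure_nonneg[of lebesgue A] 
    unfolding \<alpha>_def by linarith
  obtain M k where M: "M > 0" "k > 0" "\<And>j. real (card (brk t (k * j))) \<le> M * t ^ (k * j)"
    using card_brk_bound[OF t] by metis
  \<comment> \<open>With this value the bad set at time k j has measure at most M t^(k j) * 2
    \<delta> / t^(k j) = \<alpha> / 2, half the measure of A.\<close>
  define \<delta> where "\<delta> = \<alpha> / (4 * M)"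
  have \<delta>: "\<delta> > 0" using \<alpha> M by (simp add: \<delta>_def)
  define r where "r j = \<delta> / t ^ (k * j)" for j
  have r: "r j > 0" for j using \<delta> t0 by (simp add: r_def)
  define B where "B j = near_brk t (k * j) (r j)" for j
  have Bm: "?\<mu> (B j) \<le> \<alpha> / 2" for j
  proof -
    have "?\<mu> (B j) \<le> real (card (brk t (k * j))) * (2 * r j)"
      unfolding B_def by (rule measure_near_brk[OF t0 r])
    also have "\<dots> \<le> (M * t ^ (k * j)) * (2 * r j)"
      using M(3)[of j] r[of j] by (intro mult_right_mono) auto
    also have "\<dots> = \<alpha> / 2" using t0 M by (simp add: r_def \<delta>_def)
    finally show ?thesis .
  qed
  \<comment> \<open>Points that are bad at all times from m on. These sets increase with m and each
    lies in \<open>B m\<close>, so their union still has measure at most \<alpha> / 2; what is left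
    of A is good infinitely often.\<close>
  define N where "N m = (\<Inter>j\<in>{m..}. B j)" for m
  have Nm: "N m \<in> sets lebesgue" for m
    unfolding N_def B_def by (intro sets.countable_INT'') (auto intro: fmeasurableD)
  have "emeasure lebesgue (\<Union>m. N m) = (SUP m. emeasure lebesgue (N m))"
    by (rule SUP_emeasure_incseq[symmetric]) (use Nm in \<open>auto simp: incseq_def N_def\<close>)
  also have "\<dots> \<le> ennreal (\<alpha> / 2)"
  proof (rule SUP_least)
    fix m
    have "emeasure lebesgue (N m) \<le> emeasure lebesgue (B m)"
      by (rule emeasure_mono) (auto simp: N_def B_def intro: fmeasurableD)
    also have "\<dots> = ennreal (?\<mu> (B m))" unfolding B_def by (rule emeasure_eq_measure2) simp
    finally show "emeasure lebesgue (N m) \<le> ennreal (\<alpha> / 2)" using Bm[of m] by (meson ennreal_leI order_trans)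
  qed
  finally have NU: "emeasure lebesgue (\<Union>m. N m) \<le> ennreal (\<alpha> / 2)" .
  define G where "G = A - (\<Union>m. N m)"
  have Gm: "G \<in> sets lebesgue" unfolding G_def using A Nm by auto
  have Gpos: "emeasure lebesgue G \<ge> ennreal (\<alpha> / 2)"
  proof -
    have "ennreal \<alpha> = emeasure lebesgue A" unfolding \<alpha>_def by (rule emeasure_eq_measure2[symmetric, OF Am])
    also have "\<dots> \<le> emeasure lebesgue (G \<union> (\<Union>m. N m))"
      by (rule emeasure_mono) (use Gm Nm in \<open>auto simp: G_def intro!: sets.Un sets.countable_UN A\<close>)
    also have "\<dots> \<le> emeasure lebesgue G + emeasure lebesgue (\<Union>m. N m)"
      by (rule emeasure_subadditive) (use Gm Nm in auto)
    also have "\<dots> \<le> emeasure lebesgue G + ennreal (\<alpha> / 2)" using NU by (rule add_left_mono)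
    finally have "ennreal (\<alpha> / 2) + ennreal (\<alpha> / 2) \<le> emeasure lebesgue G + ennreal (\<alpha> / 2)"
      using \<alpha> by (simp add: ennreal_plus[symmetric] del: ennreal_plus)
    then show ?thesis 
      by (subst (asm) (2) add.commute) (simp only: ennreal_add_left_cancel_le ennreal_neq_top infinity_ennreal_def simp_thms)
  qed
  \<comment> \<open>By compactness: centres with losses tending to 0 would accumulate at some l. The
    interval of half the radius about l lies in the intervals of all nearby centres, so it would be
    contained in A up to a null set.\<close>
  have "\<exists>\<kappa>>0. \<forall>x. -1 \<le> x - \<delta> \<longrightarrow> x + \<delta> \<le> 1 \<longrightarrow> \<kappa> \<le> ?\<mu> ({x - \<delta>..x + \<delta>} - A)"
  proof (rule ccontr)
    assume "\<not> ?thesis"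
    then have "\<exists>x. -1 \<le> x - \<delta> \<and> x + \<delta> \<le> 1 \<and> ?\<mu> ({x - \<delta>..x + \<delta>} - A) < 1 / Suc n" for n
      using not_le by (metis of_nat_0_less_iff zero_less_Suc zero_less_divide_1_iff)
    then obtain X where X: "\<And>n. -1 \<le> X n - \<delta>" "\<And>n. X n + \<delta> \<le> 1" 
      "\<And>n. ?\<mu> ({X n - \<delta>..X n + \<delta>} - A) < 1 / Suc n" by metis
    have "compact {-1 + \<delta>..1 - \<delta>}" by simp
    moreover have "\<forall>n. X n \<in> {-1 + \<delta>..1 - \<delta>}" using X(1,2) by (auto simp: algebra_simps)
    ultimately obtain l f where l: "l \<in> {-1 + \<delta>..1 - \<delta>}" "strict_mono f" "(X \<circ> f) \<longlonglongrightarrow> l"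
      unfolding compact_def by blast
    define I' where "I' = {l - \<delta> / 2..l + \<delta> / 2}"
    have "eventually (\<lambda>n. \<bar>X (f n) - l\<bar> < \<delta> / 2) sequentially"
      using tendstoD[OF l(3), of "\<delta> / 2"] \<delta> by (simp add: dist_real_def)
    then have "eventually (\<lambda>n. ?\<mu> (I' - A) \<le> 1 / Suc n) sequentially"
    proof eventually_elim
      case (elim n)
      have "?\<mu> (I' - A) \<le> ?\<mu> ({X (f n) - \<delta>..X (f n) + \<delta>} - A)"
      proof (intro measure_mono_fmeasurable fmeasurable_Diff)
        have "X (f n) - \<delta> \<le> l - \<delta> / 2" "l + \<delta> / 2 \<le> X (f n) + \<delta>" using elim by linarith+
        then show "I' - A \<subseteq> {X (f n) - \<delta>..X (f n) + \<delta>} - A" unfolding I'_def by auto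
      qed (use A in \<open>auto simp: I'_def\<close>)
      also have "\<dots> \<le> 1 / Suc (f n)" using X(3)[of "f n"] by simp
      also have "\<dots> \<le> 1 / Suc n" using seq_suble[OF l(2), of n] by (simp add: frac_le)
      finally show ?case .
    qed
    then have "?\<mu> (I' - A) \<le> 0"
      by (intro tendsto_le[OF _ LIMSEQ_inverse_real_of_nat tendsto_const]) (auto simp: inverse_eq_divide)
    then have "?\<mu> (I' - A) = 0" using measure_nonneg[of lebesgue "I' - A"] by linarith
    moreover have "I' - A \<in> lmeasurable" unfolding I'_def using A by (intro fmeasurable_Diff) auto
    ultimately have "negligible (I' - A)" by (simp add: negligible_iff_measure0)
    then show False using no[of "l - \<delta> / 2" "l + \<delta> / 2"] l \<delta> unfolding I'_def by auto
  qed
  then obtain \<kappa> where \<kappa>: "\<kappa> > 0" 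
    "\<And>x. -1 \<le> x - \<delta> \<Longrightarrow> x + \<delta> \<le> 1 \<Longrightarrow> \<kappa> \<le> ?\<mu> ({x - \<delta>..x + \<delta>} - A)" by blast
  define C where "C = 2 * \<delta> / \<kappa>"
  have C: "C > 0" using \<delta> \<kappa> by (simp add: C_def)
  \<comment> \<open>The iterate maps the ball affinely onto the interval of radius \<delta> about
    the image y of x. Points landing outside A start outside A by forward invariance, so the
    proportion \<kappa> / (2 \<delta>) = 1 / C of the ball lies in the complement.\<close>
  have loss: "emeasure lebesgue (cball x (r j)) \<le> ennreal C * emeasure lebesgue (cball x (r j) - A)"
    if x: "x \<in> {-1..1}" "x \<notin> B j" for x j
  proof -
    define n where "n = k * j"
    have rn: "r j * t ^ n = \<delta>" using t0 by (simp add: r_def n_def)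
    have far: "\<bar>x - d\<bar> \<ge> r j" if "d \<in> brk t n" for d
      using x that by (auto simp: B_def near_brk_def n_def not_less)
    have xI: "-1 \<le> x - r j" "x + r j \<le> 1" using far[of 1] far[of "-1"] x by (auto simp: brk_def)
    have "\<exists>\<sigma>. \<bar>\<sigma>\<bar> = 1 \<and> (\<forall>z\<in>{x - r j..x + r j}. 
        (tent t ^^ n) z = (tent t ^^ n) (x - r j) + \<sigma> * t ^ n * (z - (x - r j)))"
    proof (rule tent_iter_affine[OF t0])
      fix i z assume iz: "i < n" "x - r j < z" "z < x + r j"
      then have "\<bar>x - z\<bar> < r j" by auto
      then have "z \<notin> brk t n" using far[of z] by auto
      moreover have "z \<in> {-1..1}" using iz xI by auto
      ultimately show "(tent t ^^ i) z \<noteq> turning_pt t" using \<open>i < n\<close> unfolding brk_def crit_def by blast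
    qed (use r[of j] in simp)
    then obtain \<sigma> where \<sigma>: "\<bar>\<sigma>\<bar> = 1" and aff: "\<And>z. z \<in> {x - r j..x + r j} \<Longrightarrow>
        (tent t ^^ n) z = (tent t ^^ n) (x - r j) + \<sigma> * t ^ n * (z - (x - r j))" by blast
    define y where "y = (tent t ^^ n) x"
    define s where "s = \<sigma> * t ^ n"
    have s: "\<bar>s\<bar> = t ^ n" "s \<noteq> 0" using \<sigma> t0 by (auto simp: s_def abs_mult)
    have aff': "(tent t ^^ n) z = y + s * (z - x)" if "z \<in> {x - r j..x + r j}" for z
      using aff[OF that] aff[of x] r[of j] unfolding y_def s_def by (simp add: algebra_simps)
    have ends: "y + s * (z - x) \<in> {-1..1}" if "z \<in> {x - r j..x + r j}" for z
      using aff'[OF that] tent_iter_in_I[OF t, of z n] that xI by auto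
    have sr: "\<bar>s * r j\<bar> = \<delta>" using s rn r[of j] by (simp add: abs_mult mult.commute)
    have yI: "-1 \<le> y - \<delta>" "y + \<delta> \<le> 1"
      using ends[of "x - r j"] ends[of "x + r j"] r[of j] sr by (auto simp: abs_if split: if_splits)
    define W where "W = {y - \<delta>..y + \<delta>} - A"
    have Wm: "W \<in> lmeasurable" unfolding W_def using A by (intro fmeasurable_Diff) auto
    have "{z. y + s * (z - x) \<in> W} \<subseteq> cball x (r j) - A"
    proof
      fix z assume "z \<in> {z. y + s * (z - x) \<in> W}"
      then have z: "\<bar>s * (z - x)\<bar> \<le> \<delta>" "y + s * (z - x) \<notin> A" by (auto simp: W_def)
      have "t ^ n * \<bar>z - x\<bar> \<le> t ^ n * r j" using z(1) s rn by (simp add: abs_mult mult.commute)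
      then have zx: "\<bar>z - x\<bar> \<le> r j" using t0 by simp
      have "(tent t ^^ n) z \<notin> A" using aff'[of z] zx z(2) by (auto simp: abs_le_iff)
      moreover have "(tent t ^^ n) z \<in> A" if "z \<in> A"
        using that inv by (induction n) auto
      ultimately show "z \<in> cball x (r j) - A" using zx by (auto simp: dist_real_def)
    qed
    then have "emeasure lebesgue {z. y + s * (z - x) \<in> W} \<le> emeasure lebesgue (cball x (r j) - A)"
      using A by (intro emeasure_mono) auto
    then have *: "ennreal (1 / \<bar>s\<bar>) * emeasure lebesgue W \<le> emeasure lebesgue (cball x (r j) - A)"
      by (simp only: emeasure_lebesgue_affine_vimage[OF s(2)])
    have "emeasure lebesgue (cball x (r j)) = ennreal (2 * r j)"
      using r[of j] by (simp add: cball_eq_atLeastAtMost)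
    also have "2 * r j = C * (1 / \<bar>s\<bar> * \<kappa>)"
      using \<kappa> s t0 by (simp add: C_def r_def n_def)
    also have "ennreal \<dots> = ennreal C * (ennreal (1 / \<bar>s\<bar>) * ennreal \<kappa>)"
      using C \<kappa> by (simp add: ennreal_mult[symmetric])
    also have "\<dots> \<le> ennreal C * (ennreal (1 / \<bar>s\<bar>) * emeasure lebesgue W)"
    proof (intro mult_left_mono)
      show "ennreal \<kappa> \<le> emeasure lebesgue W"
        unfolding emeasure_eq_measure2[OF Wm] using \<kappa>(2)[OF yI] by (intro ennreal_leI) (simp add: W_def)
    qed auto
    also have "\<dots> \<le> ennreal C * emeasure lebesgue (cball x (r j) - A)"
      using * by (intro mult_left_mono) auto
    finally show ?thesis .
  qed
  \<comment> \<open>Chosen so that C e = \<alpha> / 4, strictly below the lower bound \<alpha> / 2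
    for the measure of G.\<close>
  define e where "e = \<alpha> / (4 * C)"
  have e: "e > 0" using \<alpha> C by (simp add: e_def)
  obtain U where U: "open U" "A \<subseteq> U" "U - A \<in> lmeasurable" "emeasure lebesgue (U - A) < ennreal e"
    using sets_lebesgue_outer_open[OF A(1) e] by metis
  \<comment> \<open>The radius depends only on the time, so the covering balls are indexed by pairs
    of a centre and a time.\<close>
  define K where "K = {(x, j). x \<in> {-1..1} \<and> x \<notin> B j \<and> cball x (r j) \<subseteq> U}"
  have r_lim: "r \<longlonglongrightarrow> 0"
  proof -
    have "t ^ k > 1" using t1 M by (intro one_less_power) auto
    then have "(\<lambda>j. \<delta> / (t ^ k) ^ j) \<longlonglongrightarrow> 0" by (rule LIMSEQ_divide_realpow_zero)
    then show ?thesis by (simp add: r_def[abs_def] power_mult)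
  qed
  have cov: "\<exists>i. i \<in> K \<and> x \<in> cball (fst i) (r (snd i)) \<and> r (snd i) < d" if "x \<in> G" "d > 0" for x d
  proof -
    have x: "x \<in> A" "x \<in> {-1..1}" "\<And>m. x \<notin> N m" using that A by (auto simp: G_def)
    then obtain e' where e': "e' > 0" "cball x e' \<subseteq> U" using U open_contains_cball by blast
    have "eventually (\<lambda>j. r j < min d e') sequentially"
      by (rule order_tendstoD(2)[OF r_lim]) (use e' that in auto)
    then obtain m where m: "\<And>j. j \<ge> m \<Longrightarrow> r j < min d e'" by (auto simp: eventually_sequentially)
    obtain j where j: "j \<ge> m" "x \<notin> B j" using x(3)[of m] by (auto simp: N_def)
    have "cball x (r j) \<subseteq> U" using e' m[OF j(1)] by (meson less_imp_le min_less_iff_conj subset_cball subset_trans)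
    then have "(x, j) \<in> K" using x j by (simp add: K_def)
    then show ?thesis using m[OF j(1)] r[of j] by (intro exI[of _ "(x, j)"]) auto
  qed
  obtain Q where Q: "countable Q" "Q \<subseteq> K" 
    and disj: "pairwise (\<lambda>i j. disjnt (cball (fst i) (r (snd i))) (cball (fst j) (r (snd j)))) Q"
    and negl: "negligible (G - (\<Union>i\<in>Q. cball (fst i) (r (snd i))))"
    by (rule Vitali_covering_theorem_cballs[of K "\<lambda>i. r (snd i)" G fst, OF r cov]) auto
  define V where "V i = cball (fst i) (r (snd i))" for i :: "real \<times> nat"
  have dV: "disjoint_family_on V Q" "disjoint_family_on (\<lambda>i. V i - A) Q"
    using disj unfolding disjoint_family_on_def pairwise_def disjnt_def V_def by blast+
  have Vm: "V i \<in> sets lebesgue" for i unfolding V_def by simp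
  have VUm: "(\<Union>i\<in>Q. V i) \<in> sets lebesgue" using sets.countable_UN'[OF Q(1)] Vm by blast
  have "emeasure lebesgue G \<le> emeasure lebesgue ((G - (\<Union>i\<in>Q. V i)) \<union> (\<Union>i\<in>Q. V i))"
    using Gm VUm by (intro emeasure_mono) auto
  also have "\<dots> = emeasure lebesgue (\<Union>i\<in>Q. V i)"
    using negl Vm Q(1) unfolding V_def[symmetric] negligible_iff_null_sets 
    by (subst Un_commute, intro emeasure_Un_null_set) auto
  also have "\<dots> = (\<integral>\<^sup>+i. emeasure lebesgue (V i) \<partial>count_space Q)"
    by (rule emeasure_UN_countable) (use Vm Q dV in auto)
  also have "\<dots> \<le> (\<integral>\<^sup>+i. ennreal C * emeasure lebesgue (V i - A) \<partial>count_space Q)"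
  proof (rule nn_integral_mono)
    fix i assume "i \<in> space (count_space Q)"
    then have "i \<in> K" using Q by auto
    then show "emeasure lebesgue (V i) \<le> ennreal C * emeasure lebesgue (V i - A)"
      unfolding V_def using loss[of "fst i" "snd i"] by (auto simp: K_def split_beta)
  qed
  also have "\<dots> = ennreal C * (\<integral>\<^sup>+i. emeasure lebesgue (V i - A) \<partial>count_space Q)"
    by (rule nn_integral_cmult) simp
  also have "(\<integral>\<^sup>+i. emeasure lebesgue (V i - A) \<partial>count_space Q) = emeasure lebesgue (\<Union>i\<in>Q. V i - A)"
    by (rule emeasure_UN_countable[symmetric]) (use Vm Q dV A in auto)
  also have "\<dots> \<le> emeasure lebesgue (U - A)"
  proof (rule emeasure_mono)
    show "(\<Union>i\<in>Q. V i - A) \<subseteq> U - A" using Q(2) by (force simp: V_def K_def)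
  qed (use U in auto)
  also have "\<dots> \<le> ennreal e" using U by simp
  finally have "emeasure lebesgue G \<le> ennreal C * ennreal e" by (simp add: mult_left_mono)
  also have "\<dots> = ennreal (\<alpha> / 4)" using C e by (simp add: ennreal_mult[symmetric] e_def)
  finally have "ennreal (\<alpha> / 2) \<le> ennreal (\<alpha> / 4)" using Gpos by (rule order_trans[rotated])
  then show False using \<alpha> by simp
qed

text \<open>While the interval does not have the turning point in its interior, one application of
  the tent map stretches it by t > 1. Subintervals of I have length at most 2, so this cannot go on
  forever.\<close>

lemma invariant_contains_turning_nbhd:
  assumes t: "t \<in> Jset" and A: "A \<in> sets lebesgue" "A \<subseteq> {-1..1}" and inv: "tent t ` A \<subseteq> A"
    and pos: "\<not> negligible A"
  obtains a b where "a < turning_pt t" "turning_pt t < b" "negligible ({a..b} - A)"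
proof (rule ccontr)
  assume "\<not> thesis"
  then have no: "\<not> negligible ({a..b} - A)" if "a < turning_pt t" "turning_pt t < b" for a b
    using that \<open>\<And>a b. \<lbrakk>a < turning_pt t; turning_pt t < b; negligible ({a..b} - A)\<rbrakk> \<Longrightarrow> thesis\<close> by blast
  have t0: "t > 0" and t1: "t > 1" using t by (auto simp: Jset_def)
  obtain a b where ab: "-1 \<le> a" "a < b" "b \<le> 1" "negligible ({a..b} - A)"
    using invariant_contains_interval[OF assms] by metis
  have "\<exists>a' b'. -1 \<le> a' \<and> b' \<le> 1 \<and> b' - a' = t ^ n * (b - a) \<and> negligible ({a'..b'} - A)" for n
  proof (induction n)
    case 0 show ?case using ab by auto
  next
    case (Suc n)
    then obtain u v where uv: "-1 \<le> u" "v \<le> 1" "v - u = t ^ n * (b - a)" "negligible ({u..v} - A)" by blast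
    have "u < v" using uv(3) ab t0 by (metis diff_gt_0_iff_gt mult_pos_pos zero_less_power)
    have "\<exists>\<sigma>. \<bar>\<sigma>\<bar> = 1 \<and> (\<forall>z\<in>{u..v}. (tent t ^^ 1) z = (tent t ^^ 1) u + \<sigma> * t ^ 1 * (z - u))"
    proof (rule tent_iter_affine[OF t0])
      fix i :: nat and z assume "i < 1" "u < z" "z < v"
      then show "(tent t ^^ i) z \<noteq> turning_pt t" using no[of u v] uv by auto
    qed (use \<open>u < v\<close> in simp)
    moreover have "tent t ^^ 1 = tent t" by (simp add: fun_eq_iff)
    ultimately obtain \<sigma> where \<sigma>: "\<bar>\<sigma>\<bar> = 1" and aff: "\<And>z. z \<in> {u..v} \<Longrightarrow> tent t z = tent t u + \<sigma> * t * (z - u)" 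
      by (auto simp only: power_one_right) 
    define a' where "a' = min (tent t u) (tent t v)"
    define b' where "b' = max (tent t u) (tent t v)"
    have v: "tent t v = tent t u + \<sigma> * t * (v - u)" using aff[of v] \<open>u < v\<close> by simp
    have len: "b' - a' = t * (v - u)"
      using v \<sigma> t0 \<open>u < v\<close> unfolding a'_def b'_def by (auto simp: abs_if split: if_splits)
    have im: "{a'..b'} \<subseteq> tent t ` {u..v}"
    proof
      fix w assume w: "w \<in> {a'..b'}"
      define z where "z = u + \<sigma> * (w - tent t u) / t"
      have "\<sigma> = 1 \<or> \<sigma> = -1" using \<sigma> by auto
      then have ss: "\<sigma> * \<sigma> = 1" by auto
      have "0 \<le> \<sigma> * (w - tent t u) \<and> \<sigma> * (w - tent t u) \<le> t * (v - u)"
        using w len v t0 \<open>u < v\<close> \<open>\<sigma> = 1 \<or> \<sigma> = -1\<close> unfolding a'_def b'_def by auto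
      then have "0 \<le> \<sigma> * (w - tent t u) / t" "\<sigma> * (w - tent t u) / t \<le> v - u"
        using t0 by (simp_all add: pos_divide_le_eq mult.commute)
      then have z: "z \<in> {u..v}" by (auto simp: z_def)
      have "\<sigma> * t * (z - u) = (\<sigma> * \<sigma>) * (w - tent t u)" using t0 by (simp add: z_def)
      then have "tent t z = w" using aff[OF z] ss by simp
      then show "w \<in> tent t ` {u..v}" using z by blast
    qed
    \<comment> \<open>A missing point of the image interval can only come from a missing point of
      the interval, because A is forward invariant; affine maps preserve null sets.\<close>
    have "{a'..b'} - A \<subseteq> (\<lambda>z. tent t u + \<sigma> * t * (z - u)) ` ({u..v} - A)"
    proof
      fix w assume w: "w \<in> {a'..b'} - A"
      then obtain z where z: "z \<in> {u..v}" "w = tent t z" using im by auto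
      then have "z \<notin> A" using w inv by auto
      then show "w \<in> (\<lambda>z. tent t u + \<sigma> * t * (z - u)) ` ({u..v} - A)"
        using z(1) aff[OF z(1)] by (intro image_eqI[of _ _ z]) (simp_all only: z(2) Diff_iff simp_thms)
    qed
    moreover have "negligible ((\<lambda>z. tent t u + \<sigma> * t * (z - u)) ` ({u..v} - A))"
      using uv(4) by (intro negligible_differentiable_image_negligible)
        (auto simp: differentiable_on_def intro!: derivative_intros)
    ultimately have neg: "negligible ({a'..b'} - A)" by (rule negligible_subset[rotated])
    have "tent t u \<in> {-1..1}" "tent t v \<in> {-1..1}" using tent_in_I[OF t] uv \<open>u < v\<close> by auto
    then have "-1 \<le> a'" "b' \<le> 1" by (auto simp: a'_def b'_def)
    moreover have "b' - a' = t ^ Suc n * (b - a)" using len uv(3) by simp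
    ultimately show ?case using neg by blast
  qed
  note ex = this
  have bd: "t ^ n * (b - a) \<le> 2" for n
  proof -
    obtain a' b' where "-1 \<le> a'" "b' \<le> 1" "b' - a' = t ^ n * (b - a)" using ex[of n] by blast
    then show ?thesis by linarith
  qed
  obtain n where "2 / (b - a) < t ^ n" using real_arch_pow[OF t1] by blast
  then show False using bd[of n] ab by (simp add: pos_divide_less_eq)
qed

theorem tent_ergodic_lebesgue:
  assumes t: "t \<in> Jset" and A: "A \<in> sets lebesgue" "A \<subseteq> {-1..1}" 
    and inv: "\<And>x. x \<in> {-1..1} \<Longrightarrow> tent t x \<in> A \<longleftrightarrow> x \<in> A"
  shows "negligible A \<or> negligible ({-1..1} - A)"
proof (rule ccontr)
  assume neg: "\<not> ?thesis"
  obtain a b where ab: "a < turning_pt t" "turning_pt t < b" "negligible ({a..b} - A)"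
    by (rule invariant_contains_turning_nbhd[OF t A]) (use neg inv A in auto)
  obtain a' b' where ab': "a' < turning_pt t" "turning_pt t < b'" "negligible ({a'..b'} - ({-1..1} - A))"
    by (rule invariant_contains_turning_nbhd[OF t, of "{-1..1} - A"]) (use neg inv A tent_in_I[OF t] in auto)
  have "negligible (({a..b} - A) \<union> ({a'..b'} - ({-1..1} - A)))" using ab ab' by simp
  then have "negligible {max a a'..min b b'}" by (rule negligible_subset) auto
  moreover have "max a a' < min b b'" using ab ab' by auto
  ultimately show False using negligible_iff_measure0[of "{max a a'..min b b'}"] by auto
qed

section \<open>Birkhoff's theorem for ergodic transformations\<close>

definition birkhoff :: "('a \<Rightarrow> 'a) \<Rightarrow> ('a \<Rightarrow> real) \<Rightarrow> nat \<Rightarrow> 'a \<Rightarrow> real" where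
  "birkhoff T \<psi> n x = (\<Sum>i<n. \<psi> ((T ^^ i) x))"

lemma birkhoff_0 [simp]: "birkhoff T \<psi> 0 x = 0"
  by (simp add: birkhoff_def)

lemma birkhoff_Suc: "birkhoff T \<psi> (Suc n) x = \<psi> x + birkhoff T \<psi> n (T x)"
  unfolding birkhoff_def sum.lessThan_Suc_shift by (simp add: funpow_Suc_right del: funpow.simps)

text \<open>This is the maximum of the partial sums of lengths 0 to n. The recursive form is the
  identity on which the maximal inequality rests.\<close>

fun birkhoff_max :: "('a \<Rightarrow> 'a) \<Rightarrow> ('a \<Rightarrow> real) \<Rightarrow> nat \<Rightarrow> 'a \<Rightarrow> real" where
  "birkhoff_max T \<psi> 0 x = 0"
| "birkhoff_max T \<psi> (Suc n) x = max 0 (\<psi> x + birkhoff_max T \<psi> n (T x))"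

lemma birkhoff_max_nonneg: "birkhoff_max T \<psi> n x \<ge> 0"
  by (cases n) auto

lemma birkhoff_max_mono: "birkhoff_max T \<psi> n x \<le> birkhoff_max T \<psi> (Suc n) x"
proof (induction n arbitrary: x)
  case (Suc n) show ?case
    unfolding birkhoff_max.simps(2)[of T \<psi> n x] birkhoff_max.simps(2)[of T \<psi> "Suc n" x]
    by (intro max.mono add_left_mono order_refl Suc)
qed simp

lemma birkhoff_le_max: "k \<le> n \<Longrightarrow> birkhoff T \<psi> k x \<le> birkhoff_max T \<psi> n x"
proof (induction n arbitrary: k x)
  case (Suc n)
  show ?case
  proof (cases k)
    case 0 then show ?thesis using birkhoff_max_nonneg[of T \<psi> "Suc n" x] by simp
  next
    case (Suc j) then show ?thesis using Suc.IH[of j "T x"] Suc.prems by (simp add: birkhoff_Suc)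
  qed
qed simp

lemma birkhoff_max_attained: "\<exists>k. birkhoff_max T \<psi> n x = birkhoff T \<psi> k x"
proof (induction n arbitrary: x)
  case 0 show ?case by (rule exI[of _ 0]) simp
next
  case (Suc n)
  obtain k where "birkhoff_max T \<psi> n (T x) = birkhoff T \<psi> k (T x)" using Suc by blast
  then have "\<psi> x + birkhoff_max T \<psi> n (T x) = birkhoff T \<psi> (Suc k) x" by (simp add: birkhoff_Suc)
  then show ?case by (metis birkhoff_0 birkhoff_max.simps(2) max_def)
qed

locale mpt = prob_space M for M :: "'a measure" +
  fixes T :: "'a \<Rightarrow> 'a"
  assumes T_meas [measurable]: "T \<in> measurable M M" and T_inv: "distr M M T = M"
begin

lemma measurable_birkhoff [measurable]:
  assumes [measurable]: "\<psi> \<in> borel_measurable M"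
  shows "birkhoff T \<psi> n \<in> borel_measurable M"
  unfolding birkhoff_def[abs_def] by measurable

lemma measurable_birkhoff_max [measurable]:
  assumes [measurable]: "\<psi> \<in> borel_measurable M"
  shows "birkhoff_max T \<psi> n \<in> borel_measurable M"
proof (induction n)
  case (Suc n)
  note [measurable] = Suc
  have "(\<lambda>x. birkhoff_max T \<psi> (Suc n) x) \<in> borel_measurable M" by simp
  then show ?case .
qed (simp add: measurable_cong[of M "birkhoff_max T \<psi> 0" "\<lambda>_. 0"])

text \<open>Garsia's argument. Where the maximum M_n of the partial sums is positive, M_n \<le>
  \<psi> + M_n \<circ> T; elsewhere M_n = 0 \<le> M_n \<circ> T. Integrating, the terms in M_n
  cancel by invariance of the measure. Then n tends to infinity by dominated convergence.\<close>

lemma maximal_ergodic: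
  assumes [measurable]: "\<psi> \<in> borel_measurable M" and bd: "\<And>x. \<bar>\<psi> x\<bar> \<le> K"
  defines "E \<equiv> {x \<in> space M. \<exists>n. birkhoff T \<psi> n x > 0}"
  shows "0 \<le> (\<integral>x. indicator E x * \<psi> x \<partial>M)"
proof -
  define En where "En n = {x \<in> space M. birkhoff_max T \<psi> n x > 0}" for n
  have [measurable]: "En n \<in> sets M" for n unfolding En_def by measurable
  have K0: "K \<ge> 0" using bd[of undefined] by linarith
  have bdn: "\<bar>birkhoff_max T \<psi> n x\<bar> \<le> real n * K" for n x
  proof (induction n arbitrary: x)
    case (Suc n)
    have "\<bar>birkhoff_max T \<psi> (Suc n) x\<bar> \<le> \<bar>\<psi> x\<bar> + \<bar>birkhoff_max T \<psi> n (T x)\<bar>" by auto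
    also have "\<dots> \<le> K + real n * K" using bd Suc by (intro add_mono) auto
    finally show ?case by (simp add: algebra_simps)
  qed simp
  have int: "integrable M (birkhoff_max T \<psi> n)" for n
    by (rule integrable_const_bound[of _ "real n * K"]) (use bdn in auto)
  have intT: "integrable M (\<lambda>x. birkhoff_max T \<psi> n (T x))" for n
    by (rule integrable_const_bound[of _ "real n * K"]) (use bdn in auto)
  have inti: "integrable M (\<lambda>x. indicator (En n) x * \<psi> x)" for n
    by (rule integrable_const_bound[of _ K]) (use bd K0 in \<open>auto simp: indicator_def\<close>)
  have pos: "0 \<le> (\<integral>x. indicator (En n) x * \<psi> x \<partial>M)" for n
  proof -
    have "birkhoff_max T \<psi> n x \<le> indicator (En n) x * \<psi> x + birkhoff_max T \<psi> n (T x)" if "x \<in> space M" for x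
    proof (cases "x \<in> En n")
      case True
      then obtain m where m: "n = Suc m" by (cases n) (auto simp: En_def)
      have "birkhoff_max T \<psi> n x = \<psi> x + birkhoff_max T \<psi> m (T x)"
        using True unfolding m En_def by (auto simp: max_def split: if_splits)
      then show ?thesis using True birkhoff_max_mono[of T \<psi> m "T x"] by (simp add: m del: birkhoff_max.simps)
    next
      case False
      then show ?thesis using that birkhoff_max_nonneg[of T \<psi> n "T x"] by (auto simp: En_def)
    qed
    then have "(\<integral>x. birkhoff_max T \<psi> n x \<partial>M) \<le> (\<integral>x. indicator (En n) x * \<psi> x + birkhoff_max T \<psi> n (T x) \<partial>M)"
      by (intro integral_mono int Bochner_Integration.integrable_add inti intT)
    also have "\<dots> = (\<integral>x. indicator (En n) x * \<psi> x \<partial>M) + (\<integral>x. birkhoff_max T \<psi> n (T x) \<partial>M)"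
      by (intro Bochner_Integration.integral_add inti intT)
    also have "(\<integral>x. birkhoff_max T \<psi> n (T x) \<partial>M) = (\<integral>x. birkhoff_max T \<psi> n x \<partial>distr M M T)"
      by (rule integral_distr[symmetric]) measurable
    finally show ?thesis unfolding T_inv by simp
  qed
  have "(\<lambda>n. \<integral>x. indicator (En n) x * \<psi> x \<partial>M) \<longlonglongrightarrow> (\<integral>x. indicator E x * \<psi> x \<partial>M)"
  proof (rule integral_dominated_convergence[where w = "\<lambda>_. K"])
    have [measurable]: "E \<in> sets M" unfolding E_def by measurable
    show "(\<lambda>x. indicator E x * \<psi> x) \<in> borel_measurable M" by measurable
    show "AE x in M. (\<lambda>n. indicator (En n) x * \<psi> x) \<longlonglongrightarrow> indicator E x * \<psi> x"
    proof (rule AE_I2)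
      fix x assume x: "x \<in> space M"
      have "eventually (\<lambda>n. indicator (En n) x = (indicator E x :: real)) sequentially"
      proof (cases "x \<in> E")
        case True
        then obtain k where "birkhoff T \<psi> k x > 0" by (auto simp: E_def)
        then have "x \<in> En n" if "n \<ge> k" for n
          using birkhoff_le_max[OF that, of T \<psi> x] x by (auto simp: En_def)
        then show ?thesis using True unfolding eventually_sequentially by (intro exI[of _ k]) auto
      next
        case False
        then have "x \<notin> En n" for n 
          using birkhoff_max_attained[of T \<psi> n x] x by (auto simp: E_def En_def)
        then show ?thesis using False by simp
      qed
      then have "eventually (\<lambda>n. indicator (En n) x * \<psi> x = indicator E x * \<psi> x) sequentially"
        by eventually_elim simp
      then show "(\<lambda>n. indicator (En n) x * \<psi> x) \<longlonglongrightarrow> indicator E x * \<psi> x"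
        by (rule tendsto_eventually)
    qed
    show "AE x in M. norm (indicator (En n) x * \<psi> x) \<le> K" for n
      using bd K0 by (auto simp: indicator_def)
  qed (use inti in auto)
  then show ?thesis using pos by (intro LIMSEQ_le_const) auto
qed

end

text \<open>Ergodicity is tested on strictly invariant sets: this is the form available for the tent
  map, and the set of points with unbounded sums is of this kind.\<close>

locale ergodic_mpt = mpt +
  assumes ergodic: "\<And>A. A \<in> sets M \<Longrightarrow> (\<And>x. x \<in> space M \<Longrightarrow> T x \<in> A \<longleftrightarrow> x \<in> A) \<Longrightarrow> 
    emeasure M A = 0 \<or> emeasure M (space M - A) = 0"
begin

text \<open>Passing from x to T x changes the sums by a bounded amount, so the set where they are
  unbounded above is invariant. If it had full measure, some partial sum would be positive almost
  everywhere and the maximal inequality would give a nonnegative integral.\<close>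

lemma birkhoff_bounded_above:
  assumes [measurable]: "\<psi> \<in> borel_measurable M" and bd: "\<And>x. \<bar>\<psi> x\<bar> \<le> K" 
    and neg: "(\<integral>x. \<psi> x \<partial>M) < 0"
  shows "AE x in M. \<exists>C. \<forall>n. birkhoff T \<psi> n x \<le> C"
proof -
  define B where "B = {x \<in> space M. \<forall>j::nat. \<exists>n. birkhoff T \<psi> n x > real j}"
  have Bm [measurable]: "B \<in> sets M" unfolding B_def by measurable
  have K0: "K \<ge> 0" using bd[of undefined] by linarith
  have TB: "T x \<in> B \<longleftrightarrow> x \<in> B" if x: "x \<in> space M" for x
  proof
    assume A: "T x \<in> B"
    have "\<exists>n. birkhoff T \<psi> n x > real j" for j
    proof -
      \<comment> \<open>The margin \<lceil>K\<rceil> pays for the one additional summand \<psi>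
        x.\<close>
      obtain n where "birkhoff T \<psi> n (T x) > real (j + nat \<lceil>K\<rceil>)" using A unfolding B_def by blast
      then have "birkhoff T \<psi> (Suc n) x > real j"
        using bd[of x] real_nat_ceiling_ge[of K] unfolding birkhoff_Suc of_nat_add by linarith
      then show ?thesis by blast
    qed
    then show "x \<in> B" using x by (simp add: B_def)
  next
    assume A: "x \<in> B"
    have "\<exists>n. birkhoff T \<psi> n (T x) > real j" for j
    proof -
      obtain n where n: "birkhoff T \<psi> n x > real (j + nat \<lceil>K\<rceil>)" using A unfolding B_def by blast
      then have "n \<noteq> 0" by (intro notI) simp
      then obtain m where "n = Suc m" by (cases n) auto
      then have "birkhoff T \<psi> m (T x) > real j"
        using n bd[of x] real_nat_ceiling_ge[of K] unfolding \<open>n = Suc m\<close> birkhoff_Suc of_nat_add by linarith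
      then show ?thesis by blast
    qed
    then show "T x \<in> B" using x measurable_space[OF T_meas] by (simp add: B_def)
  qed
  have "emeasure M B = 0"
  proof (rule ccontr)
    assume "emeasure M B \<noteq> 0"
    then have "emeasure M (space M - B) = 0" using ergodic[OF Bm TB] by blast
    then have "space M - B \<in> null_sets M" by (intro null_setsI) auto
    then have "AE x in M. x \<notin> space M - B" by (rule AE_not_in)
    then have AEB: "AE x in M. x \<in> B" using AE_space by eventually_elim auto
    define E where "E = {x \<in> space M. \<exists>n. birkhoff T \<psi> n x > 0}"
    have [measurable]: "E \<in> sets M" unfolding E_def by measurable
    have "B \<subseteq> E" unfolding B_def E_def by (smt (verit) Collect_mono of_nat_0)
    have "0 \<le> (\<integral>x. indicator E x * \<psi> x \<partial>M)" unfolding E_def by (rule maximal_ergodic[OF assms(1) bd])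
    also have "\<dots> = (\<integral>x. \<psi> x \<partial>M)"
    proof (rule integral_cong_AE)
      show "AE x in M. indicator E x * \<psi> x = \<psi> x" using AEB \<open>B \<subseteq> E\<close> by (auto elim!: eventually_mono)
    qed measurable
    finally show False using neg by simp
  qed
  then have "B \<in> null_sets M" by (intro null_setsI) auto
  then have "AE x in M. x \<notin> B" by (rule AE_not_in)
  with AE_space show ?thesis
  proof eventually_elim
    case (elim x)
    then obtain j :: nat where "\<And>n. \<not> birkhoff T \<psi> n x > real j" by (auto simp: B_def)
    then show ?case by (auto simp: not_less)
  qed
qed

lemma birkhoff_upper:
  assumes [measurable]: "\<phi> \<in> borel_measurable M" and bd: "\<And>x. \<bar>\<phi> x\<bar> \<le> K" and e: "e > 0"
  shows "AE x in M. eventually (\<lambda>n. birkhoff T \<phi> n x / n < (\<integral>x. \<phi> x \<partial>M) + e) sequentially"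
proof -
  \<comment> \<open>Half of e makes the mean of \<phi> - c negative; the other half absorbs the
    bounded sums after division by n.\<close>
  define c where "c = (\<integral>x. \<phi> x \<partial>M) + e / 2"
  have int: "integrable M \<phi>" by (rule integrable_const_bound[of _ K]) (use bd in auto)
  have "AE x in M. \<exists>C. \<forall>n. birkhoff T (\<lambda>x. \<phi> x - c) n x \<le> C"
  proof (rule birkhoff_bounded_above)
    show "\<bar>\<phi> x - c\<bar> \<le> K + \<bar>c\<bar>" for x using bd[of x] by linarith
    have "(\<integral>x. \<phi> x - c \<partial>M) = (\<integral>x. \<phi> x \<partial>M) - c" using int by (simp add: prob_space)
    then show "(\<integral>x. \<phi> x - c \<partial>M) < 0" using e by (simp add: c_def)
  qed measurable
  then show ?thesis
  proof eventually_elim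
    case (elim x)
    then obtain C where C: "\<And>n. birkhoff T (\<lambda>x. \<phi> x - c) n x \<le> C" by blast
    have "(\<lambda>n. C / real n) \<longlonglongrightarrow> 0" by (rule lim_const_over_n)
    then have "eventually (\<lambda>n. C / real n < e / 2) sequentially" using e by (intro order_tendstoD) auto
    then show ?case using eventually_gt_at_top[of 0]
    proof eventually_elim
      case (elim n)
      have "birkhoff T \<phi> n x - n * c \<le> C" using C[of n] by (simp add: birkhoff_def sum_subtractf)
      then have "birkhoff T \<phi> n x / n \<le> c + C / n" using elim by (simp add: field_simps)
      then show ?case using elim unfolding c_def by linarith
    qed
  qed
qed

theorem birkhoff_ergodic:
  assumes [measurable]: "\<phi> \<in> borel_measurable M" and bd: "\<And>x. \<bar>\<phi> x\<bar> \<le> K"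
  shows "AE x in M. (\<lambda>n. birkhoff T \<phi> n x / n) \<longlonglongrightarrow> (\<integral>x. \<phi> x \<partial>M)"
proof -
  define I where "I = (\<integral>x. \<phi> x \<partial>M)"
  have "AE x in M. \<forall>j::nat. eventually (\<lambda>n. birkhoff T \<phi> n x / n < I + 1 / Suc j) sequentially"
    unfolding AE_all_countable I_def using birkhoff_upper[OF assms] by simp
  moreover have "AE x in M. \<forall>j::nat. eventually (\<lambda>n. birkhoff T (\<lambda>x. - \<phi> x) n x / n < - I + 1 / Suc j) sequentially"
    unfolding AE_all_countable I_def using birkhoff_upper[of "\<lambda>x. - \<phi> x" K] bd by simp
  ultimately show ?thesis
  proof eventually_elim
    case (elim x)
    have neg: "birkhoff T (\<lambda>x. - \<phi> x) n x = - birkhoff T \<phi> n x" for n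
      by (simp add: birkhoff_def sum_negf)
    show ?case
    proof (rule LIMSEQ_I)
      fix r :: real assume "r > 0"
      then obtain j where j: "1 / real (Suc j) < r" using nat_approx_posE by blast
      have "eventually (\<lambda>n. norm (birkhoff T \<phi> n x / n - integral\<^sup>L M \<phi>) < r) sequentially"
        using elim(1)[rule_format, of j] elim(2)[rule_format, of j]
      proof eventually_elim
        case (elim n)
        then show ?case using j unfolding neg I_def[symmetric] by (auto simp: abs_less_iff)
      qed
      then show "\<exists>no. \<forall>n\<ge>no. norm (birkhoff T \<phi> n x / n - integral\<^sup>L M \<phi>) < r"
        by (simp add: eventually_sequentially)
    qed
  qed
qed

end

section \<open>The unwrapped map and its inverse limit\<close>

locale cyl =
  fixes Phi :: "real \<Rightarrow> real \<Rightarrow> complex"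
  assumes coords: "is_cyl_coords Phi"
begin

abbreviation cylmap :: "real \<times> real \<Rightarrow> complex" where "cylmap \<equiv> (\<lambda>(y, s). Phi y s)"

lemma continuous_cylmap: "continuous_on (UNIV \<times> {0..1}) cylmap"
  and cylmap_image: "cylmap ` (UNIV \<times> {0..1}) = Dset"
  and Phi_0: "Phi y 0 = 2 * cis y" and Phi_1: "Phi y 1 = complex_of_real (cos y)"
  using coords by (auto simp: is_cyl_coords_def)

lemma Phi_eq_iff:
  assumes "s \<in> {0..1}" "s' \<in> {0..1}"
  shows "Phi y s = Phi y' s' \<longleftrightarrow>
    s = s' \<and> (if s = 1 then cos y = cos y' else (\<exists>k::int. y' = y + 2 * pi * of_int k))"
  using coords assms unfolding is_cyl_coords_def by blast

lemma Phi_in_Dset: "s \<in> {0..1} \<Longrightarrow> Phi y s \<in> Dset"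
  using cylmap_image by force

lemma Phi_reduce:
  assumes "s \<in> {0..1}"
  obtains y' where "y' \<in> {0..<2 * pi}" "Phi y s = Phi y' s"
proof
  define k where "k = \<lfloor>y / (2 * pi)\<rfloor>"
  define y' where "y' = y - 2 * pi * of_int k"
  have "of_int k \<le> y / (2 * pi)" "y / (2 * pi) < of_int k + 1" unfolding k_def by linarith+
  then show "y' \<in> {0..<2 * pi}" by (auto simp: y'_def field_simps)
  have "cos y = cos y'"
    using sin_cos_eq_iff[of y y'] by (auto simp: y'_def)
  moreover have "y' = y + 2 * pi * of_int (- k)" by (simp add: y'_def)
  ultimately show "Phi y s = Phi y' s" unfolding Phi_eq_iff[OF assms assms] by (simp only: if_split, blast)
qed

lemma Dset_cases:
  assumes "p \<in> Dset"
  obtains y s where "y \<in> {0..<2 * pi}" "s \<in> {0..1}" "p = Phi y s"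
proof -
  obtain y s where "s \<in> {0..1}" "p = Phi y s" using assms unfolding cylmap_image[symmetric] by auto
  with Phi_reduce[of s y] that show thesis by metis
qed

text \<open>Continuity can be tested in coordinates because the coordinate map restricted to one
  closed period is a closed map, its domain being compact. The fibres of the coordinate map preserve
  the level, so a union of levels E is saturated and the criterion also holds on that piece.\<close>

lemma continuous_on_cyl:
  fixes G :: "complex \<Rightarrow> 'b::topological_space"
  assumes E: "E \<subseteq> {0..1}" and cont: "continuous_on (UNIV \<times> E) (\<lambda>(y, s). G (Phi y s))"
  shows "continuous_on (cylmap ` (UNIV \<times> E)) G"
  unfolding continuous_on_closed_invariant
proof (intro allI impI)
  fix B :: "'b set" assume "closed B"
  then obtain T where T: "closed T" "T \<inter> (UNIV \<times> E) = (\<lambda>(y, s). G (Phi y s)) -` B \<inter> (UNIV \<times> E)"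
    using cont[unfolded continuous_on_closed_invariant] by blast
  define A where "A = cylmap ` (T \<inter> ({0..2 * pi} \<times> {0..1}))"
  have "compact (T \<inter> ({0..2 * pi} \<times> {0..1::real}))"
    using T(1) by (intro closed_Int_compact compact_Times) auto
  then have "compact A" unfolding A_def
    by (rule compact_continuous_image[rotated]) (auto intro: continuous_on_subset[OF continuous_cylmap])
  then have "closed A" by (rule compact_imp_closed)
  moreover have "A \<inter> cylmap ` (UNIV \<times> E) = G -` B \<inter> cylmap ` (UNIV \<times> E)"
  proof (intro set_eqI iffI)
    fix p assume "p \<in> A \<inter> cylmap ` (UNIV \<times> E)"
    then obtain y s y' s' where 1: "(y, s) \<in> T" "s \<in> {0..1}" "p = Phi y s" "s' \<in> E" "p = Phi y' s'"
      unfolding A_def by auto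
    then have "s = s'" using Phi_eq_iff[of s s' y y'] E by auto
    then have "(y, s) \<in> T \<inter> (UNIV \<times> E)" using 1 by auto
    then have "(y, s) \<in> (\<lambda>(y, s). G (Phi y s)) -` B \<inter> (UNIV \<times> E)" unfolding T(2) .
    then show "p \<in> G -` B \<inter> cylmap ` (UNIV \<times> E)" using 1(3) by auto
  next
    fix p assume "p \<in> G -` B \<inter> cylmap ` (UNIV \<times> E)"
    then obtain y s where 1: "s \<in> E" "p = Phi y s" "G p \<in> B" by auto
    then have s: "s \<in> {0..1}" using E by auto
    obtain y' where y': "y' \<in> {0..<2 * pi}" "p = Phi y' s" using Phi_reduce[OF s, of y] 1 by metis
    then have "(y', s) \<in> (\<lambda>(y, s). G (Phi y s)) -` B \<inter> (UNIV \<times> E)" using 1 by auto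
    then have "(y', s) \<in> T" unfolding T(2)[symmetric] by auto
    then have "(y', s) \<in> T \<inter> ({0..2 * pi} \<times> {0..1})" using y' s by auto
    then have "p \<in> A" unfolding A_def y'(2) by (intro image_eqI[of _ _ "(y', s)"]) auto
    then show "p \<in> A \<inter> cylmap ` (UNIV \<times> E)" using 1 by auto
  qed
  ultimately show "\<exists>A. closed A \<and> A \<inter> cylmap ` (UNIV \<times> E) = G -` B \<inter> cylmap ` (UNIV \<times> E)" by blast
qed

lemma continuous_Phi_compose:
  assumes "continuous_on X f" "continuous_on X g" "\<And>x. x \<in> X \<Longrightarrow> g x \<in> {0..1}"
  shows "continuous_on X (\<lambda>x. Phi (f x) (g x))"
proof -
  have "continuous_on X (cylmap \<circ> (\<lambda>x. (f x, g x)))"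
    using assms by (intro continuous_on_compose continuous_on_Pair continuous_on_subset[OF continuous_cylmap]) auto
  then show ?thesis by (simp add: o_def)
qed

section \<open>The level function, the collapsing map and the halving map\<close>

definition lev :: "complex \<Rightarrow> real" where "lev p = (THE s. s \<in> {0..1} \<and> (\<exists>y. p = Phi y s))"

lemma lev_Phi [simp]: assumes "s \<in> {0..1}" shows "lev (Phi y s) = s"
  unfolding lev_def
proof (rule the_equality)
  fix s' assume "s' \<in> {0..1} \<and> (\<exists>y'. Phi y s = Phi y' s')"
  then show "s' = s" using Phi_eq_iff[OF assms, of s' y] by auto
qed (use assms in auto)

lemma continuous_lev: "continuous_on Dset lev"
proof -
  have "continuous_on (UNIV \<times> {0..1}) (\<lambda>(y::real, s::real). lev (Phi y s))"
    by (rule continuous_on_eq[of _ snd]) (auto intro: continuous_on_snd continuous_on_id)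
  then show ?thesis using continuous_on_cyl[of "{0..1}" lev] cylmap_image by simp
qed

lemma lev_range: "p \<in> Dset \<Longrightarrow> 0 \<le> lev p \<and> lev p \<le> 1"
  by (elim Dset_cases) auto

text \<open>The choice in \<open>Ups\<close> is harmless: two coordinate pairs of one point share
  the level and the cosine of the angle, and the angle modulo 2 pi below level 1. On I only the
  cosine is known, but there the image has level 1 as well.\<close>

lemma Ups_Phi:
  assumes s: "s \<in> {0..1}"
  shows "Ups Phi (Phi y s) = Phi y (min (2 * s) 1)"
  unfolding Ups_def
proof (rule some_equality)
  fix q assume "\<exists>y' s'. s' \<in> {0..1} \<and> Phi y s = Phi y' s' \<and> q = Phi y' (min (2 * s') 1)"
  then obtain y' s' where s': "s' \<in> {0..1}" "Phi y s = Phi y' s'" "q = Phi y' (min (2 * s') 1)" by blast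
  then have eq: "s = s'" "if s = 1 then cos y = cos y' else (\<exists>k::int. y' = y + 2 * pi * of_int k)"
    using Phi_eq_iff[OF s s'(1)] by auto
  have "cos y = cos y'" using eq(2) sin_cos_eq_iff[of y' y] by (auto split: if_splits)
  then show "q = Phi y (min (2 * s) 1)"
    using Phi_eq_iff[of "min (2 * s) 1" "min (2 * s) 1" y y'] eq s s'(3) by (auto split: if_splits)
qed (use s in auto)

lemma Dset_cyl: "Dset = cylmap ` (UNIV \<times> {0..1})"
  by (rule cylmap_image[symmetric])

lemma continuous_Ups: "continuous_on Dset (Ups Phi)"
proof -
  have "continuous_on (UNIV \<times> {0..1}) (\<lambda>ys. Phi (fst ys) (min (2 * snd ys) 1))"
    by (intro continuous_Phi_compose continuous_intros) auto
  then have "continuous_on (UNIV \<times> {0..1}) (\<lambda>(y, s). Ups Phi (Phi y s))"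
    by (rule continuous_on_eq) (auto simp: Ups_Phi)
  then show ?thesis using continuous_on_cyl[of "{0..1}" "Ups Phi"] Dset_cyl by simp
qed

lemma Ups_in_Dset: "p \<in> Dset \<Longrightarrow> Ups Phi p \<in> Dset"
  by (elim Dset_cases) (auto simp: Ups_Phi intro!: Phi_in_Dset)

lemma lev_Ups: "p \<in> Dset \<Longrightarrow> lev (Ups Phi p) = min (2 * lev p) 1"
  by (elim Dset_cases) (auto simp: Ups_Phi)

lemma of_real_eq_Phi: "x \<in> {-1..1} \<Longrightarrow> complex_of_real x = Phi (arccos x) 1"
  by (simp add: Phi_1)

lemma lev_eq_1_iff: "p \<in> Dset \<Longrightarrow> lev p = 1 \<longleftrightarrow> p \<in> Iset"
proof (elim Dset_cases)
  fix y s assume s: "s \<in> {0..1}" "p = Phi y s"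
  show "lev p = 1 \<longleftrightarrow> p \<in> Iset"
  proof
    assume "lev p = 1"
    then have "p = of_real (cos y)" using s by (simp add: Phi_1)
    then show "p \<in> Iset" unfolding Iset_def by (intro image_eqI[of _ _ "cos y"]) auto
  next
    assume "p \<in> Iset"
    then obtain x where "x \<in> {-1..1}" "p = of_real x" by (auto simp: Iset_def)
    then have "p = Phi (arccos x) 1" by (simp add: of_real_eq_Phi)
    then show "lev p = 1" by simp
  qed
qed

lemma Iset_subset_Dset: "Iset \<subseteq> Dset"
  by (auto simp: Iset_def of_real_eq_Phi intro!: Phi_in_Dset)

lemma lev_less_1_iff: "p \<in> Dset \<Longrightarrow> lev p < 1 \<longleftrightarrow> p \<notin> Iset"
  using lev_eq_1_iff[of p] lev_range[of p] by auto

lemma lev_eq_0_iff: "p \<in> Dset \<Longrightarrow> lev p = 0 \<longleftrightarrow> norm p = 2"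
proof (elim Dset_cases)
  fix y s assume s: "s \<in> {0..1}" "p = Phi y s"
  show "lev p = 0 \<longleftrightarrow> norm p = 2"
  proof
    assume "lev p = 0"
    then have "p = 2 * cis y" using s by (simp add: Phi_0)
    then show "norm p = 2" by (simp add: norm_mult)
  next
    assume n: "norm p = 2"
    obtain a where "p = cmod p * cis a" using rcis_cmod_Arg[of p] unfolding rcis_def by metis
    then have "p = Phi a 0" using n by (simp add: Phi_0)
    then show "lev p = 0" by simp
  qed
qed

text \<open>Inverts the doubling of levels off I. On I, where different angles give the same point,
  its value is an arbitrary choice.\<close>

definition half :: "complex \<Rightarrow> complex" where
  "half p = (SOME q. \<exists>y s. s \<in> {0..1} \<and> p = Phi y s \<and> q = Phi y (s / 2))"

lemma half_Phi:
  assumes s: "s \<in> {0..<1}"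
  shows "half (Phi y s) = Phi y (s / 2)"
  unfolding half_def
proof (rule some_equality)
  have s01: "s \<in> {0..1}" using s by auto
  then show "\<exists>y' s'. s' \<in> {0..1} \<and> Phi y s = Phi y' s' \<and> Phi y (s / 2) = Phi y' (s' / 2)" by blast
  fix q assume "\<exists>y' s'. s' \<in> {0..1} \<and> Phi y s = Phi y' s' \<and> q = Phi y' (s' / 2)"
  then obtain y' s' where s': "s' \<in> {0..1}" "Phi y s = Phi y' s'" "q = Phi y' (s' / 2)" by blast
  then have "s = s'" "\<exists>k::int. y' = y + 2 * pi * of_int k"
    using Phi_eq_iff[OF s01 s'(1)] s by auto
  then show "q = Phi y (s / 2)"
    using Phi_eq_iff[of "s / 2" "s / 2" y y'] s s'(3) by auto
qed

lemma Dset_minus_Iset_cyl: "Dset - Iset = cylmap ` (UNIV \<times> {0..<1})"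
proof (intro set_eqI iffI)
  fix p assume p: "p \<in> Dset - Iset"
  then obtain y s where "s \<in> {0..1}" "p = Phi y s" by (auto elim: Dset_cases)
  moreover from this have "s < 1" using p lev_less_1_iff[of p] by auto
  ultimately show "p \<in> cylmap ` (UNIV \<times> {0..<1})" by (intro image_eqI[of _ _ "(y, s)"]) auto
next
  fix p assume "p \<in> cylmap ` (UNIV \<times> {0..<1})"
  then obtain y s where s: "s \<in> {0..<1}" "p = Phi y s" by auto
  then have "p \<in> Dset" using Phi_in_Dset[of s y] by auto
  then show "p \<in> Dset - Iset" using s lev_less_1_iff[of p] by auto
qed

lemma continuous_half: "continuous_on (Dset - Iset) half"
proof -
  have "continuous_on (UNIV \<times> {0..<1}) (\<lambda>ys. Phi (fst ys) (snd ys / 2))"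
    by (intro continuous_Phi_compose continuous_intros) auto
  then have "continuous_on (UNIV \<times> {0..<1}) (\<lambda>(y, s). half (Phi y s))"
    by (rule continuous_on_eq) (auto simp: half_Phi)
  then show ?thesis unfolding Dset_minus_Iset_cyl by (intro continuous_on_cyl) auto
qed

lemma half_pow_Phi: "s \<in> {0..<1} \<Longrightarrow> (half ^^ n) (Phi y s) = Phi y (s / 2 ^ n)"
proof (induction n)
  case (Suc n)
  have "s / 2 ^ n \<le> s / 1" using Suc.prems by (intro divide_left_mono) auto
  moreover have "0 \<le> s / 2 ^ n" using Suc.prems by simp
  ultimately have "s / 2 ^ n \<in> {0..<1}" using Suc.prems unfolding atLeastLessThan_iff by linarith
  then show ?case using Suc half_Phi[of "s / 2 ^ n" y] by (simp add: mult.commute)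
qed simp

lemma half_in: "p \<in> Dset - Iset \<Longrightarrow> half p \<in> Dset - Iset"
  unfolding Dset_minus_Iset_cyl by (auto simp: half_Phi intro!: image_eqI[of _ _ "(a, b / 2)" for a b])

lemma half_pow_in: "p \<in> Dset - Iset \<Longrightarrow> (half ^^ n) p \<in> Dset - Iset"
  by (induction n) (simp_all add: half_in del: Diff_iff)

lemma continuous_half_pow: "continuous_on (Dset - Iset) (half ^^ n)"
proof (induction n)
  case (Suc n)
  have "continuous_on ((half ^^ n) ` (Dset - Iset)) half"
    by (rule continuous_on_subset[OF continuous_half]) (use half_pow_in in blast)
  then show ?case using continuous_on_compose[OF Suc] by simp
qed (simp add: id_def)

end

locale unwrapping = cyl Phi for Phi +
  fixes F :: "complex \<Rightarrow> complex" and t :: real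
  assumes continuous_F: "continuous_on Dset F" and near: "op_near_homeo_D F"
    and F_on_I: "\<And>x. x \<in> {-1..1} \<Longrightarrow> Ups Phi (F (complex_of_real x)) = complex_of_real (tent t x)"
    and F_id: "\<And>y s. s \<in> {0..3/4} \<Longrightarrow> F (Phi y s) = Phi y s"
    and t_Jset: "t \<in> Jset"
begin

lemma F_in_Dset: "p \<in> Dset \<Longrightarrow> F p \<in> Dset"
  using near by (auto simp: op_near_homeo_D_def)

lemma F_low: "p \<in> Dset \<Longrightarrow> lev p \<le> 3/4 \<Longrightarrow> F p = p"
  by (elim Dset_cases) (auto simp: F_id)

text \<open>If F sent a point p above level 3/4 to a point q below it, then F q = q as well, so the connected
  preimage of a small convex neighbourhood of q under an approximating homeomorphism joins p to q. It
  crosses the level 3/4, where F is the identity and hence stays away from q.\<close>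
lemma F_high:
  assumes p: "p \<in> Dset" "lev p > 3/4"
  shows "lev (F p) \<ge> 3/4"
proof (rule ccontr)
  define q where "q = F p"
  assume "\<not> ?thesis"
  then have q: "q \<in> Dset" "lev q < 3/4" using F_in_Dset p by (auto simp: q_def)
  define L where "L = {w \<in> Dset. lev w = 3/4}"
  have "closed L" unfolding L_def
    by (intro continuous_closed_preimage_constant continuous_lev) (simp add: Dset_def)
  moreover have "q \<notin> L" using q by (simp add: L_def)
  ultimately obtain d where d: "d > 0" "\<And>w. w \<in> L \<Longrightarrow> d \<le> dist q w"
    using separate_point_closed[of L q] by blast
  obtain h where h: "\<And>k. op_homeo_D (h k)" "uniform_limit Dset h F sequentially"
    using near by (auto simp: op_near_homeo_D_def)
  have "eventually (\<lambda>k. \<forall>w\<in>Dset. dist (h k w) (F w) < d / 2) sequentially"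
    using uniform_limitD[OF h(2), of "d / 2"] d by simp
  then obtain k where k: "\<And>w. w \<in> Dset \<Longrightarrow> dist (h k w) (F w) < d / 2"
    by (auto simp: eventually_sequentially)
  obtain g where g: "homeomorphism Dset Dset (h k) g" using h(1)[of k] by (auto simp: op_homeo_D_def)
  define W where "W = Dset \<inter> ball q (d / 2)"
  have hin: "h k w \<in> Dset" "g (h k w) = w" if "w \<in> Dset" for w
    using g that by (auto simp: homeomorphism_def)
  have gin: "g w \<in> Dset" "h k (g w) = w" if "w \<in> Dset" for w
    using g that by (auto simp: homeomorphism_def)
  have "convex W" unfolding W_def Dset_def by (intro convex_Int convex_cball convex_ball)
  then have "connected (g ` W)"
    using homeomorphism_cont2[OF g]
    by (intro connected_continuous_image convex_connected) (auto simp: W_def intro: continuous_on_subset)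
  moreover have "g ` W \<subseteq> Dset" using gin by (auto simp: W_def)
  ultimately have conn: "connected (lev ` g ` W)"
    using connected_continuous_image[OF continuous_on_subset[OF continuous_lev]] by blast
  have pW: "lev p \<in> lev ` g ` W"
  proof -
    have "h k p \<in> W" using k[OF p(1)] hin[OF p(1)] by (simp add: W_def q_def dist_commute)
    then show ?thesis using hin(2)[OF p(1)] by (metis imageI)
  qed
  have qW: "lev q \<in> lev ` g ` W"
  proof -
    have "F q = q" using q by (intro F_low) auto
    then have "h k q \<in> W" using k[OF q(1)] hin[OF q(1)] by (simp add: W_def dist_commute)
    then show ?thesis using hin(2)[OF q(1)] by (metis imageI)
  qed
  have "3/4 \<in> lev ` g ` W"
    by (rule connectedD_interval[OF conn qW pW]) (use p(2) q(2) in simp_all)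
  then obtain w where w: "w \<in> W" "lev (g w) = 3/4" by auto
  then have gw: "g w \<in> L" using gin by (auto simp: L_def W_def)
  have "w \<in> Dset" using w by (simp add: W_def)
  have "F (g w) = g w" using gw by (intro F_low) (auto simp: L_def)
  then have "dist w (g w) < d / 2" using k[of "g w"] gin[OF \<open>w \<in> Dset\<close>] by simp
  moreover have "dist q w < d / 2" using w by (simp add: W_def)
  ultimately show False using d(2)[OF gw] dist_triangle[of q "g w" w] by linarith
qed

definition H :: "complex \<Rightarrow> complex" where "H p = Ups Phi (F p)"

lemma H_in_Dset: "p \<in> Dset \<Longrightarrow> H p \<in> Dset"
  by (simp add: H_def Ups_in_Dset F_in_Dset)

lemma continuous_H: "continuous_on Dset H"
proof -
  have "continuous_on (F ` Dset) (Ups Phi)"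
    by (rule continuous_on_subset[OF continuous_Ups]) (use F_in_Dset in blast)
  then show ?thesis using continuous_on_compose[OF continuous_F] by (simp add: H_def[abs_def] o_def)
qed

lemma H_Phi: "s \<in> {0..3/4} \<Longrightarrow> H (Phi y s) = Phi y (min (2 * s) 1)"
  by (auto simp: H_def F_id Ups_Phi)

lemma H_of_real: "x \<in> {-1..1} \<Longrightarrow> H (complex_of_real x) = complex_of_real (tent t x)"
  by (simp add: H_def F_on_I)

text \<open>Up to level 3/4 the unwrapping is the identity. Above it, \<open>F_high\<close> keeps
  the level at least 3/4, and all levels from 1/2 on are collapsed to 1. So no point above 3/4 can
  return below level 1.\<close>

lemma lev_H: assumes p: "p \<in> Dset" shows "lev (H p) = min (2 * lev p) 1"
proof (cases "lev p \<le> 3/4")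
  case True
  then show ?thesis using F_low[OF p] lev_Ups[OF p] by (simp add: H_def)
next
  case False
  then have "lev (F p) \<ge> 3/4" using F_high[OF p] by simp
  then show ?thesis using False lev_Ups[OF F_in_Dset[OF p]] by (simp add: H_def)
qed

text \<open>A preimage of a point outside I has level below 1/2, where \<open>H\<close> only doubles
  the level; so it is unique.\<close>

lemma H_eq_half:
  assumes q: "q \<in> Dset" and p: "lev (H q) < 1"
  shows "half (H q) = q"
proof -
  obtain y s where s: "s \<in> {0..1}" "q = Phi y s" using q by (elim Dset_cases)
  have "2 * s < 1" using p lev_H[OF q] s by auto
  then have "H q = Phi y (2 * s)" using s H_Phi[of s y] by auto
  then show ?thesis using half_Phi[of "2 * s" y] s \<open>2 * s < 1\<close> by auto
qed

lemma H_half: "p \<in> Dset - Iset \<Longrightarrow> H (half p) = p"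
  unfolding Dset_minus_Iset_cyl by (auto simp: half_Phi H_Phi)

lemma H_pow_in: "p \<in> Dset \<Longrightarrow> (H ^^ n) p \<in> Dset"
  by (induction n) (simp_all add: H_in_Dset)

lemma continuous_H_pow: "continuous_on Dset (H ^^ n)"
proof (induction n)
  case (Suc n)
  have "continuous_on ((H ^^ n) ` Dset) H"
    by (rule continuous_on_subset[OF continuous_H]) (use H_pow_in in blast)
  then show ?case using continuous_on_compose[OF Suc] by simp
qed (simp add: id_def)

lemma H_pow_of_real: "x \<in> {-1..1} \<Longrightarrow> (H ^^ n) (complex_of_real x) = complex_of_real ((tent t ^^ n) x)"
  by (induction n) (simp_all add: H_of_real tent_iter_in_I[OF t_Jset] del: atLeastAtMost_iff)

section \<open>Threads of the inverse limit\<close>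

lemma hatD_in: "z \<in> hatD H \<Longrightarrow> z n \<in> Dset" and hatD_step: "z \<in> hatD H \<Longrightarrow> H (z (Suc n)) = z n"
  by (auto simp: hatD_def)

lemma hatD_pow: "z \<in> hatD H \<Longrightarrow> (H ^^ j) (z (n + j)) = z n"
  by (induction j) (simp_all add: funpow_Suc_right hatD_step del: funpow.simps)

lemma hatD_lev: "z \<in> hatD H \<Longrightarrow> lev (z n) = min (2 * lev (z (Suc n))) 1"
  using lev_H[OF hatD_in, of z "Suc n"] hatD_step[of z n] by simp

lemma hatD_half_pow:
  assumes z: "z \<in> hatD H" and n: "lev (z n) < 1"
  shows "z (n + j) = (half ^^ j) (z n)"
proof -
  have "z (n + j) = (half ^^ j) (z n) \<and> lev (z (n + j)) < 1"
  proof (induction j)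
    case (Suc j)
    have "min (2 * lev (z (Suc (n + j)))) 1 < 1" using Suc unfolding hatD_lev[OF z, of "n + j"] by blast
    moreover have "0 \<le> lev (z (Suc (n + j)))" using lev_range[OF hatD_in[OF z]] by blast
    ultimately have "lev (z (n + Suc j)) < 1" by (simp add: min_def split: if_splits)
    moreover have "half (z (n + j)) = z (n + Suc j)"
    proof -
      have l: "lev (H (z (Suc (n + j)))) < 1" unfolding hatD_step[OF z] by (rule Suc[THEN conjunct2])
      show ?thesis using H_eq_half[OF hatD_in[OF z] l] by (simp only: hatD_step[OF z] add_Suc_right)
    qed
    ultimately show ?case using Suc by simp
  qed (use n in simp)
  then show ?thesis ..
qed

text \<open>For p outside I this is the only thread with N-th entry p, and it depends continuously
  on p. It provides both charts of the inverse limit and a closed form for \<Psi>.\<close>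

definition thread :: "nat \<Rightarrow> complex \<Rightarrow> nat \<Rightarrow> complex" where
  "thread N p = (\<lambda>n. if n \<le> N then (H ^^ (N - n)) p else (half ^^ (n - N)) p)"

lemma thread_at [simp]: "thread N p N = p"
  by (simp add: thread_def)

lemma thread_in_hatD:
  assumes p: "p \<in> Dset - Iset"
  shows "thread N p \<in> hatD H"
proof -
  have "thread N p n \<in> Dset" for n
    using H_pow_in[of p] half_pow_in[OF p] p by (auto simp: thread_def)
  moreover have "H (thread N p (Suc n)) = thread N p n" for n
  proof (cases "n < N")
    case True
    then have "N - n = Suc (N - Suc n)" by simp
    then show ?thesis using True by (simp add: thread_def)
  next
    case False
    then have "Suc n - N = Suc (n - N)" by simp
    then have "H (thread N p (Suc n)) = H (half ((half ^^ (n - N)) p))" using False by (simp add: thread_def)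
    also have "\<dots> = (half ^^ (n - N)) p" by (rule H_half[OF half_pow_in[OF p]])
    also have "\<dots> = thread N p n" using False by (auto simp: thread_def)
    finally show ?thesis .
  qed
  ultimately show ?thesis by (simp add: hatD_def)
qed

lemma thread_eq:
  assumes z: "z \<in> hatD H" and N: "lev (z N) < 1"
  shows "thread N (z N) = z"
proof
  fix n
  show "thread N (z N) n = z n"
    using hatD_pow[OF z, of "N - n" n] hatD_half_pow[OF z N, of "n - N"] by (auto simp: thread_def)
qed

lemma continuous_thread: "continuous_on (Dset - Iset) (thread N)"
proof (rule continuous_on_coordinatewise_then_product)
  fix n
  show "continuous_on (Dset - Iset) (\<lambda>p. thread N p n)"
    using continuous_on_subset[OF continuous_H_pow, of "Dset - Iset" "N - n"] continuous_half_pow[of "n - N"]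
    by (cases "n \<le> N") (auto simp: thread_def)
qed

lemma hatI_iff: "z \<in> hatD H \<Longrightarrow> z \<in> hatI H \<longleftrightarrow> (\<forall>n. lev (z n) = 1)"
  using lev_eq_1_iff[OF hatD_in] by (auto simp: hatI_def)

end

section \<open>The measure transported by \<Psi>\<close>

lemma Aset_borel [measurable]: "Aset \<in> sets borel"
  unfolding Aset_def borel_prod[symmetric] by (intro pair_measureI) auto

lemma measurable_m_dens [measurable]: "m_dens \<in> borel_measurable borel"
  unfolding m_dens_def[abs_def]
  by (intro measurable_compose[OF _ measurable_ennreal] borel_measurable_continuous_onI continuous_intros)
    (auto simp: add_nonneg_eq_0_iff)

lemma space_m_meas [simp]: "space m_meas = Aset"
  by (simp add: m_meas_def space_restrict_space)

lemma sets_m_meas: "sets m_meas = sets (restrict_space borel Aset)"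
  unfolding m_meas_def sets_density by (rule sets_restrict_space_cong) simp

text \<open>A factor 2 pi from the circle and a factor pi / 2 from the half line, where the density
  has primitive arctan.\<close>

lemma m_mass: "(\<integral>\<^sup>+ u. m_dens u \<partial>(restrict_space lborel Aset)) = ennreal (pi\<^sup>2)"
proof -
  have 1: "m_dens u * indicator Aset u = 
    indicator {0..<2 * pi} (fst u) * (ennreal (1 / (1 + (snd u)\<^sup>2)) * indicator {0..} (snd u))" for u
    by (cases u) (auto simp: m_dens_def Aset_def indicator_def)
  have "(\<integral>\<^sup>+ u. m_dens u \<partial>(restrict_space lborel Aset)) = (\<integral>\<^sup>+ u. m_dens u * indicator Aset u \<partial>lborel)"
    by (intro nn_integral_restrict_space) simp
  also have "\<dots> = (\<integral>\<^sup>+ y. \<integral>\<^sup>+ s. m_dens (y, s) * indicator Aset (y, s) \<partial>lborel \<partial>lborel)"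
    unfolding lborel_prod[symmetric] by (rule lborel.nn_integral_fst[symmetric]) (simp add: lborel_prod)
  also have "\<dots> = (\<integral>\<^sup>+ y. indicator {0..<2 * pi} y * 
      (\<integral>\<^sup>+ s. ennreal (1 / (1 + s\<^sup>2)) * indicator {0..} s \<partial>lborel) \<partial>lborel)"
    unfolding 1 by (simp add: nn_integral_cmult)
  also have "(\<integral>\<^sup>+ s. ennreal (1 / (1 + s\<^sup>2)) * indicator {0..} s \<partial>lborel) = ennreal (pi / 2 - arctan 0)"
    by (rule nn_integral_FTC_atLeast) 
      (auto intro!: derivative_eq_intros tendsto_arctan_at_top simp: inverse_eq_divide)
  also have "(\<integral>\<^sup>+ y. indicator {0..<2 * pi} y * ennreal (pi / 2 - arctan 0) \<partial>lborel) 
      = ennreal (2 * pi) * ennreal (pi / 2)"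
    by (simp add: nn_integral_multc)
  also have "\<dots> = ennreal (pi\<^sup>2)" by (simp add: ennreal_mult[symmetric] power2_eq_square)
  finally show ?thesis .
qed

lemma prob_space_m_meas: "prob_space m_meas"
proof
  have "emeasure m_meas (space m_meas) = 
      (\<integral>\<^sup>+ u. m_dens u / ennreal (pi\<^sup>2) * indicator Aset u \<partial>restrict_space lborel Aset)"
    unfolding space_m_meas unfolding m_meas_def m_mass
    by (rule emeasure_density) (auto simp: sets_restrict_space_iff intro!: measurable_restrict_space1)
  also have "\<dots> = (\<integral>\<^sup>+ u. m_dens u / ennreal (pi\<^sup>2) \<partial>restrict_space lborel Aset)"
    by (intro nn_integral_cong) (auto simp: space_restrict_space)
  also have "\<dots> = ennreal (pi\<^sup>2) / ennreal (pi\<^sup>2)"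
    unfolding m_mass[symmetric] by (rule nn_integral_divide) (auto intro!: measurable_restrict_space1)
  also have "\<dots> = 1" by (simp add: divide_ennreal)
  finally show "emeasure m_meas (space m_meas) = 1" .
qed

text \<open>The density is strictly positive, so \<open>m_meas\<close> and Lebesgue measure have the
  same null sets in A. Apart from total mass 1, this is all that later arguments use about
  \<open>m_meas\<close>.\<close>

lemma m_meas_eq_0_iff:
  assumes X: "X \<in> sets borel" "X \<subseteq> Aset"
  shows "emeasure m_meas X = 0 \<longleftrightarrow> emeasure lborel X = 0"
proof -
  let ?L = "restrict_space lborel Aset"
  have XL: "X \<in> sets ?L" using X by (simp add: sets_restrict_space_iff)
  have nz: "m_dens u / ennreal (pi\<^sup>2) \<noteq> 0" for u
    by (simp add: m_dens_def divide_ennreal add_pos_nonneg add_nonneg_eq_0_iff)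
  have "emeasure m_meas X = 0 \<longleftrightarrow> X \<in> null_sets m_meas"
    using XL by (auto simp: null_sets_def m_meas_def)
  also have "\<dots> \<longleftrightarrow> X \<in> sets ?L \<and> (AE u in ?L. u \<in> X \<longrightarrow> m_dens u / ennreal (pi\<^sup>2) = 0)"
    unfolding m_meas_def m_mass by (rule null_sets_density_iff) (auto intro!: measurable_restrict_space1)
  also have "\<dots> \<longleftrightarrow> (AE u in ?L. u \<notin> X)" using XL nz by simp
  also have "\<dots> \<longleftrightarrow> X \<in> null_sets ?L" by (rule AE_iff_null_sets[OF XL, symmetric])
  also have "\<dots> \<longleftrightarrow> emeasure lborel X = 0" 
    using X by (subst null_sets_restrict_space) (auto simp: null_sets_def)
  finally show ?thesis .
qed

lemma closed_Iset: "closed Iset"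
proof -
  have "compact Iset" unfolding Iset_def
    by (intro compact_continuous_image continuous_intros) auto
  then show ?thesis by (rule compact_imp_closed)
qed

context unwrapping begin

section \<open>\<Psi> as a parametrisation of the threads that leave I\<close>

lemma hatD_lev_less: "z \<in> hatD H \<Longrightarrow> lev (z n) < 1 \<Longrightarrow> n \<le> m \<Longrightarrow> lev (z m) < 1"
  using hatD_half_pow[of z n "m - n"] half_pow_in[of "z n" "m - n"] lev_less_1_iff[OF hatD_in, of z n] 
    lev_less_1_iff[of "z m"] hatD_in[of z] by auto

text \<open>The level of the k-th entry of \<Psi>(y, s) for s in [k, k + 1). For k \<ge> 1 it runs
  through [1/2, 1), one fundamental domain of doubling; for k = 0 it runs through all of [0,
  1).\<close>

definition fund_lev :: "nat \<Rightarrow> real \<Rightarrow> real" where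
  "fund_lev k s = (if k = 0 then s else (s - real k + 1) / 2)"

lemma fund_lev_range: "s \<in> {real k..<real k + 1} \<Longrightarrow> fund_lev k s \<in> {0..<1}"
  by (auto simp: fund_lev_def)

lemma Psi_eq_thread:
  assumes s: "s \<in> {real k..<real k + 1}"
  shows "Psi Phi H (y, s) = thread k (Phi y (fund_lev k s))"
proof
  fix n
  have fl: "\<lfloor>s\<rfloor> = int k" using s by (intro floor_unique) auto
  note v = fund_lev_range[OF s]
  show "Psi Phi H (y, s) n = thread k (Phi y (fund_lev k s)) n"
  proof (cases "k = 0")
    case True
    then show ?thesis using s half_pow_Phi[of s n y] by (auto simp: Psi_def Let_def thread_def fund_lev_def)
  next
    case False
    then show ?thesis using s fl half_pow_Phi[OF v, of "n - k" y] 
      by (auto simp: Psi_def Let_def thread_def fund_lev_def)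
  qed
qed

lemma Aset_cases:
  assumes "a \<in> Aset"
  obtains y s k where "a = (y, s)" "y \<in> {0..<2 * pi}" "0 \<le> s" "s \<in> {real k..<real k + 1}"
proof -
  obtain y s where a: "a = (y, s)" "y \<in> {0..<2 * pi}" "0 \<le> s" using assms by (auto simp: Aset_def)
  have "s \<in> {real (nat \<lfloor>s\<rfloor>)..<real (nat \<lfloor>s\<rfloor>) + 1}"
    using a by (auto simp: of_nat_nat)
  with a that show thesis by blast
qed

lemma Phi_fund_in: "s \<in> {real k..<real k + 1} \<Longrightarrow> Phi y (fund_lev k s) \<in> Dset - Iset"
  using fund_lev_range[of s k] unfolding Dset_minus_Iset_cyl by (intro image_eqI[of _ _ "(y, fund_lev k s)"]) auto

lemma Psi_in_hatD: "s \<in> {real k..<real k + 1} \<Longrightarrow> Psi Phi H (y, s) \<in> hatD H"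
  by (simp only: Psi_eq_thread thread_in_hatD Phi_fund_in)

lemma Psi_at: "s \<in> {real k..<real k + 1} \<Longrightarrow> Psi Phi H (y, s) k = Phi y (fund_lev k s)"
  by (simp only: Psi_eq_thread thread_at)

lemma lev_Psi_at: "s \<in> {real k..<real k + 1} \<Longrightarrow> lev (Psi Phi H (y, s) k) = fund_lev k s"
  using fund_lev_range[of s k] by (simp add: Psi_at)

text \<open>The entry before the k-th already lies in I because the k-th has level at least 1/2.
  Hence the integer part of s can be read off the thread, which is the key to injectivity.\<close>

lemma lev_Psi_less_1_iff:
  assumes s: "s \<in> {real k..<real k + 1}"
  shows "lev (Psi Phi H (y, s) n) < 1 \<longleftrightarrow> k \<le> n"
proof
  assume "k \<le> n"
  then show "lev (Psi Phi H (y, s) n) < 1"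
    using hatD_lev_less[OF Psi_in_hatD[OF s], of y k n] lev_Psi_at[OF s, of y] fund_lev_range[OF s] by auto
next
  assume less: "lev (Psi Phi H (y, s) n) < 1"
  show "k \<le> n"
  proof (rule ccontr)
    assume "\<not> k \<le> n"
    then obtain j where k: "k = Suc j" and "n \<le> j" by (cases k) auto
    have "lev (Psi Phi H (y, s) j) < 1" by (rule hatD_lev_less[OF Psi_in_hatD[OF s] less \<open>n \<le> j\<close>])
    moreover have "lev (Psi Phi H (y, s) j) = min (2 * fund_lev k s) 1"
      using hatD_lev[OF Psi_in_hatD[OF s], of y j] lev_Psi_at[OF s, of y] by (simp add: k)
    moreover have "2 * fund_lev k s \<ge> 1" using s by (simp add: fund_lev_def k)
    ultimately show False by simp
  qed
qed

lemma inj_on_Psi: "inj_on (Psi Phi H) Aset"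
proof (rule inj_onI)
  fix a b assume "a \<in> Aset" "b \<in> Aset" and eq: "Psi Phi H a = Psi Phi H b"
  then obtain y s k y' s' k' where a: "a = (y, s)" "y \<in> {0..<2 * pi}" and s: "s \<in> {real k..<real k + 1}"
    and b: "b = (y', s')" "y' \<in> {0..<2 * pi}" and s': "s' \<in> {real k'..<real k' + 1}"
    by (metis Aset_cases)
  have "k \<le> n \<longleftrightarrow> k' \<le> n" for n
    using lev_Psi_less_1_iff[OF s, of y n] lev_Psi_less_1_iff[OF s', of y' n] eq a b by simp
  then have k: "k' = k" by (meson order_antisym order_refl)
  have v: "fund_lev k s \<in> {0..1}" "fund_lev k s' \<in> {0..1}" "fund_lev k s \<noteq> 1"
    using fund_lev_range[OF s] fund_lev_range[OF s'] k by auto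
  have "Phi y (fund_lev k s) = Phi y' (fund_lev k s')"
    using Psi_at[OF s, of y] Psi_at[OF s', of y'] eq a b k by simp
  then have "fund_lev k s = fund_lev k s'" and "\<exists>j::int. y' = y + 2 * pi * of_int j"
    using Phi_eq_iff[OF v(1,2)] v(3) by auto
  then obtain j :: int where j: "y' = y + 2 * pi * of_int j" by blast
  have "\<bar>y' - y\<bar> < 2 * pi" using a(2) b(2) by auto
  then have "2 * pi * \<bar>of_int j\<bar> < 2 * pi * 1" using j by (simp add: abs_mult)
  then have "\<bar>real_of_int j\<bar> < 1" by simp
  then have "j = 0" by linarith
  moreover have "s = s'" using \<open>fund_lev k s = fund_lev k s'\<close> by (auto simp: fund_lev_def split: if_splits)
  ultimately show "a = b" using a b j by simp
qed

lemma Psi_notin_hatI: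
  assumes s: "s \<in> {real k..<real k + 1}"
  shows "Psi Phi H (y, s) \<notin> hatI H"
  using hatI_iff[OF Psi_in_hatD[OF s], of y] lev_Psi_less_1_iff[OF s, of y k] by auto

lemma Psi_surj:
  assumes z: "z \<in> hatD H" "z \<notin> hatI H"
  obtains a where "a \<in> Aset" "Psi Phi H a = z"
proof -
  have "\<exists>n. lev (z n) < 1" using hatI_iff[OF z(1)] z(2) lev_range[OF hatD_in[OF z(1)]] by (meson le_less)
  define k where "k = (LEAST n. lev (z n) < 1)"
  have k: "lev (z k) < 1" unfolding k_def using \<open>\<exists>n. lev (z n) < 1\<close> by (rule LeastI_ex)
  obtain y v where y: "y \<in> {0..<2 * pi}" and v: "v \<in> {0..1}" "z k = Phi y v"
    using hatD_in[OF z(1), of k] by (elim Dset_cases)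
  have v1: "v < 1" using k v by simp
  \<comment> \<open>Solves \<open>fund_lev k s = v\<close>. Minimality of k gives 2 v \<ge> 1 when k
    > 0, which puts s in [k, k + 1).\<close>
  define s where "s = (if k = 0 then v else 2 * v + real k - 1)"
  have s: "s \<in> {real k..<real k + 1} \<and> s \<ge> 0"
  proof (cases k)
    case 0 then show ?thesis using v v1 by (simp add: s_def)
  next
    case (Suc j)
    have "\<not> lev (z j) < 1" using not_less_Least[of j "\<lambda>n. lev (z n) < 1"] Suc by (simp add: k_def)
    moreover have "lev (z j) = min (2 * v) 1" using hatD_lev[OF z(1), of j] v Suc by simp
    ultimately have "2 * v \<ge> 1" by (simp add: min_def split: if_splits)
    then show ?thesis using v1 Suc by (simp add: s_def)
  qed
  have "fund_lev k s = v" by (simp add: fund_lev_def s_def)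
  then have "Psi Phi H (y, s) = z" using s Psi_eq_thread[of s k y] thread_eq[OF z(1) k] v by simp
  moreover have "(y, s) \<in> Aset" using y s by (simp add: Aset_def)
  ultimately show thesis using that by blast
qed

text \<open>Continuity on the half-open strips is enough: they form a countable Borel partition, and
  a point of a strip has small rectangles to its upper right inside the same strip.\<close>

lemma continuous_Psi_piece: "continuous_on (UNIV \<times> {real k..<real k + 1}) (Psi Phi H)"
proof -
  let ?X = "UNIV \<times> {real k..<real k + 1}"
  have "continuous_on ?X (\<lambda>a. fund_lev k (snd a))"
    unfolding fund_lev_def by (cases "k = 0") (auto intro!: continuous_intros)
  then have 1: "continuous_on ?X (\<lambda>a. Phi (fst a) (fund_lev k (snd a)))"
  proof (rule continuous_Phi_compose[rotated])
    fix a assume "a \<in> ?X"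
    then show "fund_lev k (snd a) \<in> {0..1}" using fund_lev_range[of "snd a" k] by auto
  qed (intro continuous_intros)
  have "continuous_on ((\<lambda>a. Phi (fst a) (fund_lev k (snd a))) ` ?X) (thread k)"
    by (rule continuous_on_subset[OF continuous_thread]) (use Phi_fund_in in auto)
  from continuous_on_compose[OF 1 this] show ?thesis
    by (rule continuous_on_eq) (auto simp: Psi_eq_thread)
qed

lemma hatD_nonhatI_dense:
  assumes U: "openin (top_of_set (hatD H)) U" "U \<noteq> {}"
  obtains a where "a \<in> Aset" "Psi Phi H a \<in> U"
proof -
  obtain U' where U': "open U'" "U = hatD H \<inter> U'" using U(1) by (auto simp: openin_open)
  obtain z where z: "z \<in> hatD H" "z \<in> U'" using U(2) U' by auto
  have "\<exists>w\<in>hatD H - hatI H. w \<in> U'"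
  proof (cases "z \<in> hatI H")
    case True
    have "\<exists>y. z N = Phi y 1" for N
    proof -
      have "z N \<in> Iset" using True by (simp add: hatI_def)
      then obtain x where "x \<in> {-1..1}" "z N = of_real x" unfolding Iset_def by blast
      then show ?thesis using of_real_eq_Phi by metis
    qed
    then obtain y where y: "\<And>N. z N = Phi (y N) 1" by metis
    \<comment> \<open>The point at level 1/2 with the same angle is mapped by \<open>H\<close> to z
      N. Using it as entry N + 1 changes no entry up to N but makes the thread leave I.\<close>
    define w where "w N = thread (Suc N) (Phi (y N) (1/2))" for N
    have half: "Phi (y N) (1/2) \<in> Dset - Iset" for N
      unfolding Dset_minus_Iset_cyl by (intro image_eqI[of _ _ "(y N, 1/2)"]) auto
    have w: "w N \<in> hatD H" for N unfolding w_def by (rule thread_in_hatD[OF half])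
    have wI: "w N \<notin> hatI H" for N
      using hatI_iff[OF w, of N] lev_less_1_iff[of "Phi (y N) (1/2)"] half[of N] 
      by (auto simp: w_def dest!: spec[of _ "Suc N"])
    have "w N n = z n" if "n \<le> N" for n N
    proof -
      have "w N N = z N" using hatD_step[OF w, of N N] H_Phi[of "1/2" "y N"] y[of N] by (simp add: w_def)
      then show ?thesis using hatD_pow[OF w, of "N - n" N n] hatD_pow[OF z(1), of "N - n" n] that by simp
    qed
    then have "((\<lambda>N. w N n) \<longlongrightarrow> z n) sequentially" for n
      by (intro tendsto_eventually) (auto simp: eventually_sequentially)
    then have "limitin (product_topology (\<lambda>_. euclidean) UNIV) w z sequentially"
      unfolding limitin_componentwise by simp
    then have "w \<longlonglongrightarrow> z" by (simp add: euclidean_product_topology)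
    then have "eventually (\<lambda>N. w N \<in> U') sequentially" using U'(1) z(2) by (rule topological_tendstoD)
    then obtain N where "w N \<in> U'" by (auto simp: eventually_sequentially)
    then show ?thesis using w wI by blast
  qed (use z in blast)
  then obtain w where "w \<in> hatD H" "w \<notin> hatI H" "w \<in> U'" by blast
  then show thesis using Psi_surj[of w] that U' by (metis IntI)
qed

text \<open>The N-th coordinate is a chart with inverse \<open>thread N\<close>, with values in the
  open disk minus I. Positive level excludes the boundary circle, level below 1 excludes I.\<close>

lemma not_in_boundary:
  assumes z: "z \<in> hatD H" and N: "0 < lev (z N)" "lev (z N) < 1"
  shows "z \<notin> mfd_boundary2 (hatD H)"
proof -
  define V where "V = ball 0 2 - Iset"
  have V: "p \<in> V \<longleftrightarrow> 0 < lev p \<and> lev p < 1" if "p \<in> Dset" for p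
    using lev_less_1_iff[OF that] lev_eq_0_iff[OF that] lev_range[OF that] that by (auto simp: V_def Dset_def)
  have VD: "V \<subseteq> Dset - Iset" by (auto simp: V_def Dset_def)
  have "open V" unfolding V_def by (intro open_Diff closed_Iset) auto
  define U where "U = hatD H \<inter> (\<lambda>z. z N) -` V"
  have oU: "openin (top_of_set (hatD H)) U"
    unfolding U_def using \<open>open V\<close> by (intro openin_open_Int open_vimage) auto
  have "homeomorphism U V (\<lambda>z. z N) (thread N)"
  proof (rule homeomorphismI)
    show "continuous_on U (\<lambda>z. z N)" by (rule continuous_on_subset[OF continuous_on_product_coordinates]) auto
    show "continuous_on V (thread N)" by (rule continuous_on_subset[OF continuous_thread VD])
    show "(\<lambda>z. z N) ` U \<subseteq> V" by (auto simp: U_def)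
    show "thread N ` V \<subseteq> U" using VD thread_in_hatD by (auto simp: U_def)
    show "thread N (z N) = z" if "z \<in> U" for z
      using that V[OF hatD_in] by (intro thread_eq) (auto simp: U_def)
  qed simp
  then have "U homeomorphic V" by (auto simp: homeomorphic_def)
  moreover have "z \<in> U" using z N V[OF hatD_in[OF z]] by (simp add: U_def)
  ultimately show ?thesis using oU \<open>open V\<close> unfolding mfd_boundary2_def by blast
qed

section \<open>The push-forward measure and its Oxtoby-Ulam property\<close>

lemma measurable_Psi: "Psi Phi H \<in> measurable m_meas (restrict_space borel (hatD H))"
proof -
  have "Psi Phi H \<in> borel_measurable (restrict_space borel Aset)"
  proof (rule measurable_piecewise_restrict[where C = "range (\<lambda>k::nat. (UNIV :: real set) \<times> {real k..<real k + 1})"])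
    fix X assume "X \<in> range (\<lambda>k::nat. (UNIV :: real set) \<times> {real k..<real k + 1}) "
    then obtain k where X: "X = (UNIV :: real set) \<times> {real k..<real k + 1}" by auto
    have Xb: "X \<in> sets borel" unfolding X borel_prod[symmetric] by (intro pair_measureI) auto
    then show "X \<inter> space (restrict_space borel Aset) \<in> sets (restrict_space borel Aset)"
      by (auto simp: sets_restrict_space_iff space_restrict_space)
    have "restrict_space (restrict_space borel Aset) X = restrict_space borel (Aset \<inter> X)"
      using Xb by (intro restrict_restrict_space) auto
    moreover have "continuous_on (Aset \<inter> X) (Psi Phi H)"
      unfolding X by (rule continuous_on_subset[OF continuous_Psi_piece]) auto
    ultimately show "Psi Phi H \<in> borel_measurable (restrict_space (restrict_space borel Aset) X)"
      by (simp add: borel_measurable_continuous_on_restrict)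
  next
    show "space (restrict_space borel Aset) \<subseteq> \<Union> (range (\<lambda>k::nat. (UNIV :: real set) \<times> {real k..<real k + 1}))"
    proof
      fix a assume "a \<in> space (restrict_space borel Aset)"
      then have "a \<in> Aset" by (simp add: space_restrict_space)
      then show "a \<in> \<Union> (range (\<lambda>k::nat. (UNIV :: real set) \<times> {real k..<real k + 1}))" by (elim Aset_cases) auto
    qed
  qed auto
  then have "Psi Phi H \<in> measurable m_meas borel"
    using measurable_cong_sets[OF sets_m_meas refl] by blast
  moreover have "Psi Phi H \<in> space m_meas \<rightarrow> hatD H"
    using Psi_in_hatD by (auto elim!: Aset_cases)
  ultimately show ?thesis by (rule measurable_restrict_space2[rotated])
qed

lemma Psi_vimage_diff: "Psi Phi H -` (E - hatI H) \<inter> space m_meas = Psi Phi H -` E \<inter> space m_meas"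
proof -
  have "Psi Phi H a \<notin> hatI H" if "a \<in> Aset" for a
    using that Psi_notin_hatI by (auto elim!: Aset_cases)
  then show ?thesis by auto
qed

text \<open>Since \<Psi> never meets the inverse limit of I, removing that set changes no preimage.
  As a push-forward, \<open>rho'\<close> is known to be countably additive, so its
  \<open>emeasure\<close> is the prescribed set function.\<close>

lemma rho'_eq_distr: "rho' Phi H = distr m_meas (restrict_space borel (hatD H)) (Psi Phi H)"
  unfolding rho'_def distr_def Psi_vimage_diff by (simp add: space_restrict_space)

lemma space_rho': "space (rho' Phi H) = hatD H"
  and sets_rho': "sets (rho' Phi H) = sets (restrict_space borel (hatD H))"
  unfolding rho'_eq_distr by (simp_all add: space_restrict_space)

lemma emeasure_rho':
  assumes "E \<in> sets (restrict_space borel (hatD H))"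
  shows "emeasure (rho' Phi H) E = emeasure m_meas (Psi Phi H -` E \<inter> Aset)"
  unfolding rho'_eq_distr using emeasure_distr[OF measurable_Psi assms] by simp

lemma rho'_null:
  assumes E: "E \<in> sets (restrict_space borel (hatD H))"
    and sub: "Psi Phi H -` E \<inter> Aset \<subseteq> X" and X: "X \<in> null_sets lborel"
  shows "emeasure (rho' Phi H) E = 0"
proof -
  let ?P = "Psi Phi H -` E \<inter> Aset"
  have "?P \<in> sets m_meas" using measurable_sets[OF measurable_Psi E] by simp
  then have P: "?P \<in> sets borel" using Aset_borel by (simp add: sets_m_meas sets_restrict_space_iff)
  then have "emeasure lborel ?P = 0"
    using emeasure_mono[OF sub, of lborel] X by (simp add: null_sets_def)
  then show ?thesis using m_meas_eq_0_iff[OF P] emeasure_rho'[OF E] by simp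
qed

lemma rho'_pos:
  assumes E: "E \<in> sets (restrict_space borel (hatD H))"
    and sub: "X \<subseteq> Psi Phi H -` E \<inter> Aset" and X: "X \<in> sets borel" "emeasure lborel X > 0"
  shows "emeasure (rho' Phi H) E > 0"
proof -
  let ?P = "Psi Phi H -` E \<inter> Aset"
  have Pm: "?P \<in> sets m_meas" using measurable_sets[OF measurable_Psi E] by simp
  have "emeasure m_meas X > 0"
    using m_meas_eq_0_iff[OF X(1)] sub X(2) by (auto simp: zero_less_iff_neq_zero)
  also have "\<dots> \<le> emeasure m_meas ?P" by (rule emeasure_mono[OF sub Pm])
  finally show ?thesis using emeasure_rho'[OF E] by simp
qed

lemma emeasure_lborel_Times_real:
  fixes A B :: "real set"
  assumes "A \<in> sets borel" "B \<in> sets borel"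
  shows "emeasure lborel (A \<times> B) = emeasure lborel A * emeasure lborel B"
  unfolding lborel_prod[symmetric] using assms by (intro lborel.emeasure_pair_measure_Times) auto

theorem oxtoby_ulam_rho': "oxtoby_ulam (hatD H) (rho' Phi H)"
  unfolding oxtoby_ulam_def
proof (intro conjI ballI allI impI)
  show "prob_space (rho' Phi H)"
    unfolding rho'_eq_distr by (rule prob_space.prob_space_distr[OF prob_space_m_meas measurable_Psi])
  show "space (rho' Phi H) = hatD H" "sets (rho' Phi H) = sets (restrict_space borel (hatD H))"
    by (rule space_rho' sets_rho')+
next
  fix x assume "x \<in> hatD H"
  then have x: "{x} \<in> sets (restrict_space borel (hatD H))"
    by (auto simp: sets_restrict_space intro!: image_eqI[of _ _ "{x}"])
  have "finite (Psi Phi H -` {x} \<inter> Aset)"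
    using finite_vimage_IntI[OF _ inj_on_Psi, of "{x}"] by simp
  then show "emeasure (rho' Phi H) {x} = 0"
    by (intro rho'_null[OF x order_refl] finite_imp_null_set_lborel)
next
  fix U assume U: "openin (top_of_set (hatD H)) U \<and> U \<noteq> {}"
  then obtain U' where U': "open U'" "U = hatD H \<inter> U'" by (auto simp: openin_open)
  have Um: "U \<in> sets (restrict_space borel (hatD H))"
    using U' by (auto simp: sets_restrict_space)
  obtain a where "a \<in> Aset" "Psi Phi H a \<in> U" using hatD_nonhatI_dense U by metis
  then obtain y s k where y: "y \<in> {0..<2 * pi}" "0 \<le> s" and s: "s \<in> {real k..<real k + 1}"
    and PU: "Psi Phi H (y, s) \<in> U" by (metis Aset_cases)
  let ?X = "UNIV \<times> {real k..<real k + 1}"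
  obtain T where T: "open T" "T \<inter> ?X = Psi Phi H -` U' \<inter> ?X"
    using continuous_Psi_piece[of k, unfolded continuous_on_open_invariant] U'(1) by blast
  have "(y, s) \<in> Psi Phi H -` U' \<inter> ?X" using PU s U' by auto
  then have "(y, s) \<in> T" unfolding T(2)[symmetric] by auto
  then obtain A B where AB: "open A" "open B" "y \<in> A" "s \<in> B" "A \<times> B \<subseteq> T"
    using open_prod_elim[OF T(1)] by (metis mem_Sigma_iff)
  obtain e1 where e1: "e1 > 0" "cball y e1 \<subseteq> A" using AB open_contains_cball by blast
  obtain e2 where e2: "e2 > 0" "cball s e2 \<subseteq> B" using AB open_contains_cball by blast
  \<comment> \<open>The rectangle grows only to the right and upwards from (y, s), since that point
    may lie on the closed sides of its half-open strip. Halving the remaining distances keeps it off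
    the open sides.\<close>
  define d1 where "d1 = min e1 ((2 * pi - y) / 2)"
  define d2 where "d2 = min e2 ((real k + 1 - s) / 2)"
  have d: "d1 > 0" "d2 > 0" using e1 e2 y s by (auto simp: d1_def d2_def)
  have d1: "{y..y + d1} \<subseteq> A" "y + d1 < 2 * pi" 
  proof -
    have "{y..y + d1} \<subseteq> cball y e1" by (auto simp: d1_def dist_real_def)
    then show "{y..y + d1} \<subseteq> A" using e1 by blast
    have "d1 \<le> (2 * pi - y) / 2" unfolding d1_def by (rule min.cobounded2)
    then show "y + d1 < 2 * pi" using y by auto
  qed
  have d2: "{s..s + d2} \<subseteq> B" "s + d2 < real k + 1"
  proof -
    have "{s..s + d2} \<subseteq> cball s e2" by (auto simp: d2_def dist_real_def)
    then show "{s..s + d2} \<subseteq> B" using e2 by blast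
    have "d2 \<le> (real k + 1 - s) / 2" unfolding d2_def by (rule min.cobounded2)
    then show "s + d2 < real k + 1" using s by auto
  qed
  let ?R = "{y..y + d1} \<times> {s..s + d2}"
  show "emeasure (rho' Phi H) U > 0"
  proof (rule rho'_pos[OF Um])
    show "?R \<subseteq> Psi Phi H -` U \<inter> Aset"
    proof
      fix b assume b: "b \<in> ?R"
      then have bX: "b \<in> ?X" using s d2(2) by auto
      moreover have "b \<in> T" using b d1 d2 AB by auto
      ultimately have "b \<in> Psi Phi H -` U' \<inter> ?X" unfolding T(2)[symmetric] by auto
      moreover have "Psi Phi H b \<in> hatD H" using bX Psi_in_hatD by auto
      moreover have "b \<in> Aset" using b y d1(2) by (auto simp: Aset_def)
      ultimately show "b \<in> Psi Phi H -` U \<inter> Aset" using U' by auto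
    qed
    show "?R \<in> sets borel" by (intro borel_closed closed_Times) auto
    show "emeasure lborel ?R > 0"
      using d by (simp add: emeasure_lborel_Times_real ennreal_mult[symmetric])
  qed
next
  \<comment> \<open>A relatively closed, hence measurable, set containing the manifold boundary. Its
    preimage under \<Psi> lies in the circle s = 0, because the k-th entry of \<Psi>(y, s) has level
    strictly between 0 and 1 for every s > 0.\<close>
  define Bd where "Bd = hatD H - (\<Union>N. {z \<in> hatD H. 0 < lev (z N) \<and> lev (z N) < 1})"
  have "openin (top_of_set (hatD H)) {z \<in> hatD H. 0 < lev (z N) \<and> lev (z N) < 1}" for N
  proof -
    have "continuous_on (hatD H) (\<lambda>z. lev (z N))"
      by (rule continuous_on_compose2[OF continuous_lev continuous_on_subset[OF continuous_on_product_coordinates]])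
        (auto simp: hatD_in)
    then have "openin (top_of_set (hatD H)) (hatD H \<inter> (\<lambda>z. lev (z N)) -` {0<..<1})"
      by (rule continuous_openin_preimage_gen) simp
    then show ?thesis by (simp add: Int_def vimage_def)
  qed
  then have "openin (top_of_set (hatD H)) (\<Union>N. {z \<in> hatD H. 0 < lev (z N) \<and> lev (z N) < 1})" by blast
  then obtain W where W: "open W" "(\<Union>N. {z \<in> hatD H. 0 < lev (z N) \<and> lev (z N) < 1}) = hatD H \<inter> W"
    by (auto simp: openin_open)
  have Bdm: "Bd \<in> sets (restrict_space borel (hatD H))"
    unfolding Bd_def W(2) sets_restrict_space using W(1) by (intro image_eqI[of _ _ "- W"]) auto
  have "emeasure (rho' Phi H) Bd = 0"
  proof (rule rho'_null[OF Bdm])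
    show "Psi Phi H -` Bd \<inter> Aset \<subseteq> {0..2 * pi} \<times> {0}"
    proof
      fix a assume a: "a \<in> Psi Phi H -` Bd \<inter> Aset"
      then obtain y s k where ys: "a = (y, s)" "y \<in> {0..<2 * pi}" "0 \<le> s" and s: "s \<in> {real k..<real k + 1}"
        by (metis Aset_cases IntD2)
      have "\<not> (0 < lev (Psi Phi H (y, s) k) \<and> lev (Psi Phi H (y, s) k) < 1)"
        using a Psi_in_hatD[OF s, of y] by (auto simp: Bd_def ys)
      then have "fund_lev k s \<le> 0" using lev_Psi_at[OF s, of y] fund_lev_range[OF s] by auto
      then have "s = 0" using s ys by (auto simp: fund_lev_def split: if_splits)
      then show "a \<in> {0..2 * pi} \<times> {0}" using ys by auto
    qed
    show "{0..2 * pi} \<times> {0::real} \<in> null_sets lborel"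
    proof (rule null_setsI)
      show "emeasure lborel ({0..2 * pi} \<times> {0::real}) = 0"
        by (subst emeasure_lborel_Times_real) auto
    qed (auto intro!: borel_closed closed_Times)
  qed
  moreover have "mfd_boundary2 (hatD H) \<subseteq> Bd"
    using not_in_boundary by (auto simp: Bd_def mfd_boundary2_def)
  ultimately show "emeasure (rho' Phi H) (mfd_boundary2 (hatD H)) = 0"
    using emeasure_mono[of "mfd_boundary2 (hatD H)" Bd "rho' Phi H"] Bdm sets_rho' by (metis le_zero_eq)
qed

end

section \<open>Regular points\<close>

text \<open>The Boolean selects the real or the imaginary part. Lists over a countable type keep the
  family countable, so that almost-everywhere statements may be intersected over all
  monomials.\<close>

definition coord_monomial :: "(nat \<times> bool) list \<Rightarrow> (nat \<Rightarrow> complex) \<Rightarrow> real" where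
  "coord_monomial l z = (\<Prod>(n, b)\<leftarrow>l. if b then Re (z n) else Im (z n))"

lemma coord_monomial_Nil [simp]: "coord_monomial [] z = 1"
  and coord_monomial_Cons [simp]: "coord_monomial ((n, b) # l) z = (if b then Re (z n) else Im (z n)) * coord_monomial l z"
  and coord_monomial_append: "coord_monomial (l @ l') z = coord_monomial l z * coord_monomial l' z"
  by (simp_all add: coord_monomial_def)

lemma continuous_coord_monomial: 
  assumes "\<And>n. continuous_on X (\<lambda>x. f x n)"
  shows "continuous_on X (\<lambda>x. coord_monomial l (f x))"
proof (induction l)
  case (Cons a l)
  obtain n b where a: "a = (n, b)" by (cases a)
  show ?case using Cons assms[of n] unfolding a coord_monomial_Cons
    by (cases b) (auto intro!: continuous_intros)
qed simp

lemma coord_monomial_cong: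
  "(\<And>n b. (n, b) \<in> set l \<Longrightarrow> z n = z' n) \<Longrightarrow> coord_monomial l z = coord_monomial l z'"
proof (induction l)
  case (Cons a l)
  obtain n b where a: "a = (n, b)" by (cases a)
  have "z n = z' n" using Cons.prems a by auto
  moreover have "coord_monomial l z = coord_monomial l z'" using Cons by auto
  ultimately show ?case by (simp add: a)
qed simp

lemma coord_monomial_le_1:
  assumes "\<And>n. norm (z n) \<le> 1"
  shows "\<bar>coord_monomial l z\<bar> \<le> 1"
proof (induction l)
  case (Cons a l)
  obtain n b where a: "a = (n, b)" by (cases a)
  have "\<bar>if b then Re (z n) else Im (z n)\<bar> \<le> 1"
    using assms[of n] abs_Re_le_cmod[of "z n"] abs_Im_le_cmod[of "z n"] by auto
  then show ?case using Cons unfolding a coord_monomial_Cons abs_mult by (intro mult_le_one) auto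
qed simp

inductive_set coord_polys :: "((nat \<Rightarrow> complex) \<Rightarrow> real) set" where
  monomial: "(\<lambda>z. c * coord_monomial l z) \<in> coord_polys"
| add: "g \<in> coord_polys \<Longrightarrow> h \<in> coord_polys \<Longrightarrow> (\<lambda>z. g z + h z) \<in> coord_polys"

lemma coord_polys_mult:
  assumes "g \<in> coord_polys" "h \<in> coord_polys"
  shows "(\<lambda>z. g z * h z) \<in> coord_polys"
  using assms
proof (induction g rule: coord_polys.induct)
  case (monomial c l)
  from monomial.prems show ?case
  proof (induction h rule: coord_polys.induct)
    case (monomial c' l')
    have "(\<lambda>z. (c * c') * coord_monomial (l @ l') z) \<in> coord_polys" by (rule coord_polys.monomial)
    then show ?case by (simp add: coord_monomial_append mult_ac)
  next
    case (add g h)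
    then show ?case using coord_polys.add by (simp add: distrib_left)
  qed
next
  case (add g g')
  then show ?case using coord_polys.add[OF add.IH] by (simp add: distrib_right)
qed

lemma continuous_coord_polys: "g \<in> coord_polys \<Longrightarrow> continuous_on X g"
proof (induction rule: coord_polys.induct)
  case (monomial c l)
  have "continuous_on X (\<lambda>z. coord_monomial l z)"
    by (rule continuous_coord_monomial) (rule continuous_on_subset[OF continuous_on_product_coordinates subset_UNIV])
  then show ?case by (intro continuous_intros)
qed (intro continuous_intros)

lemma coord_polys_dense:
  assumes "compact X" "continuous_on X f" "e > 0"
  obtains g where "g \<in> coord_polys" "\<And>z. z \<in> X \<Longrightarrow> \<bar>f z - g z\<bar> < e"
proof -
  have "\<exists>g. g \<in> coord_polys \<and> (\<forall>z\<in>X. \<bar>f z - g z\<bar> < e)"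
  proof (rule Stone_Weierstrass_HOL)
    show "(\<lambda>z. c) \<in> coord_polys" for c using coord_polys.monomial[of c "[]"] by simp
    show "\<exists>g. g \<in> coord_polys \<and> g z \<noteq> g w" if "z \<in> X \<and> w \<in> X \<and> z \<noteq> w" for z w
    proof -
      obtain n where n: "z n \<noteq> w n" using \<open>z \<in> X \<and> w \<in> X \<and> z \<noteq> w\<close> by auto
      obtain b where "(if b then Re (z n) else Im (z n)) \<noteq> (if b then Re (w n) else Im (w n))"
        using n complex_eqI[of "z n" "w n"] by (metis (full_types))
      then show ?thesis by (intro exI[of _ "\<lambda>z. 1 * coord_monomial [(n, b)] z"] conjI coord_polys.monomial) auto
    qed
  qed (use assms in \<open>auto intro: coord_polys.add coord_polys_mult continuous_coord_polys\<close>)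
  then show thesis using that by blast
qed

text \<open>Discarding finitely many initial terms does not affect the limit of averages. One term
  at a time costs a factor n / (n + 1) and a summand of order 1 / n.\<close>

lemma average_shift:
  fixes a :: "nat \<Rightarrow> real"
  assumes "(\<lambda>n. (\<Sum>i<n. a (i + N)) / real n) \<longlonglongrightarrow> L"
  shows "(\<lambda>n. (\<Sum>i<n. a i) / real n) \<longlonglongrightarrow> L"
  using assms
proof (induction N arbitrary: a)
  case (Suc N)
  define A where "A n = (\<Sum>i<n. a (Suc i)) / real n" for n
  have "A \<longlonglongrightarrow> L" unfolding A_def using Suc.IH[of "\<lambda>i. a (Suc i)"] Suc.prems by simp
  then have "(\<lambda>n. A n * (real n / real (Suc n)) + a 0 / real (Suc n)) \<longlonglongrightarrow> L * 1 + 0"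
    by (intro tendsto_intros LIMSEQ_n_over_Suc_n LIMSEQ_Suc[OF lim_const_over_n])
  moreover have "A n * (real n / real (Suc n)) + a 0 / real (Suc n) = (\<Sum>i<Suc n. a i) / real (Suc n)" for n
    unfolding sum.lessThan_Suc_shift A_def by (cases "n = 0") (simp_all add: add_divide_distrib)
  ultimately have "(\<lambda>n. (\<Sum>i<Suc n. a i) / real (Suc n)) \<longlonglongrightarrow> L" by simp
  then show ?case by (rule LIMSEQ_imp_Suc)
qed simp

text \<open>The natural extension shifts entries to the right and puts new ones in front, so after n
  steps the n-th entry follows the orbit of the zeroth.\<close>

lemma hatH_pow: "n \<le> i \<Longrightarrow> (hatH G ^^ i) z n = (G ^^ (i - n)) (z 0)"
proof (induction i arbitrary: n)
  case (Suc i)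
  then show ?case by (cases n) (auto simp: hatH_def)
qed simp

context unwrapping begin

lemma compact_hatD: "compact (hatD H)"
proof -
  have "compact Dset" by (simp add: Dset_def)
  then have "compactin (product_topology (\<lambda>_. euclidean) UNIV) (PiE UNIV (\<lambda>_::nat. Dset))"
    by (subst compactin_PiE) (auto simp: compactin_euclidean_iff)
  then have cP: "compact (PiE UNIV (\<lambda>_::nat. Dset))" 
    by (simp add: euclidean_product_topology)
  define P where "P = PiE UNIV (\<lambda>_::nat. Dset)"
  have P: "compact P" "closed P" using cP compact_imp_closed by (auto simp: P_def)
  have pc: "continuous_on P (\<lambda>z. z n)" for n :: nat
    by (rule continuous_on_subset[OF continuous_on_product_coordinates subset_UNIV])
  have "closed {z \<in> P. H (z (Suc n)) - z n = 0}" for n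
  proof (rule continuous_closed_preimage_constant[OF _ P(2)])
    have "continuous_on P (\<lambda>z. H (z (Suc n)))"
      by (rule continuous_on_compose2[OF continuous_H pc]) (auto simp: P_def)
    then show "continuous_on P (\<lambda>z. H (z (Suc n)) - z n)" by (intro continuous_intros pc)
  qed
  then have "closed (\<Inter>n. {z \<in> P. H (z (Suc n)) - z n = 0})" by blast
  moreover have "hatD H = (\<Inter>n. {z \<in> P. H (z (Suc n)) - z n = 0})"
    by (auto simp: hatD_def P_def)
  ultimately have "closed (hatD H)" by simp
  then have "compact (P \<inter> hatD H)" by (rule compact_Int_closed[OF P(1)])
  moreover have "P \<inter> hatD H = hatD H" using hatD_in by (auto simp: P_def)
  ultimately show ?thesis by simp
qed

lemma hatH_pow_in: "z \<in> hatD H \<Longrightarrow> (hatH H ^^ i) z \<in> hatD H"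
proof (induction i)
  case (Suc i)
  then have "(hatH H ^^ i) z \<in> hatD H" by simp
  then have "hatH H ((hatH H ^^ i) z) \<in> hatD H"
    by (auto simp: hatD_def hatH_def H_in_Dset split: nat.split)
  then show ?case by simp
qed simp

text \<open>Regularity only has to be tested on the countably many monomials in the coordinates. This makes
  the set of regular points measurable, so that its measure is not the junk value 0.\<close>
lemma regular_pt_iff:
  assumes "prob_space \<nu>" and \<nu>: "space \<nu> = hatD H" "sets \<nu> = sets (restrict_space borel (hatD H))"
    and z: "z \<in> hatD H"
  shows "regular_pt (hatD H) (hatH H) \<nu> z \<longleftrightarrow>
    (\<forall>l. (\<lambda>n. (\<Sum>i<n. coord_monomial l ((hatH H ^^ i) z)) / real n) \<longlonglongrightarrow> (\<integral>w. coord_monomial l w \<partial>\<nu>))"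
    (is "_ \<longleftrightarrow> (\<forall>l. ?C (coord_monomial l))")
proof
  assume "regular_pt (hatD H) (hatH H) \<nu> z"
  moreover have "continuous_on (hatD H) (coord_monomial l)" for l
    using continuous_coord_polys[OF coord_polys.monomial[of 1 l]] by simp
  ultimately show "\<forall>l. ?C (coord_monomial l)" by (simp add: regular_pt_def)
next
  assume C: "\<forall>l. ?C (coord_monomial l)"
  interpret prob_space \<nu> by fact
  have int: "integrable \<nu> \<alpha>" if \<alpha>: "continuous_on (hatD H) \<alpha>" for \<alpha> :: "(nat \<Rightarrow> complex) \<Rightarrow> real"
  proof -
    have "compact (\<alpha> ` hatD H)" by (rule compact_continuous_image[OF \<alpha> compact_hatD])
    then obtain K where K: "\<And>w. w \<in> hatD H \<Longrightarrow> norm (\<alpha> w) \<le> K"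
      using compact_imp_bounded bounded_iff by (metis imageI)
    have "\<alpha> \<in> borel_measurable \<nu>"
      using borel_measurable_continuous_on_restrict[OF \<alpha>] measurable_cong_sets[OF \<nu>(2) refl] by blast
    then show ?thesis using K by (intro integrable_const_bound[of _ K] AE_I2) (auto simp: \<nu>(1))
  qed
  have poly: "?C g" if "g \<in> coord_polys" for g
    using that
  proof (induction rule: coord_polys.induct)
    case (monomial c l)
    have "(\<lambda>n. c * ((\<Sum>i<n. coord_monomial l ((hatH H ^^ i) z)) / real n)) \<longlonglongrightarrow> c * (\<integral>w. coord_monomial l w \<partial>\<nu>)"
      by (intro tendsto_mult tendsto_const C[rule_format])
    then show ?case by (simp add: sum_distrib_left)
  next
    case (add g h)
    have "(\<integral>w. g w + h w \<partial>\<nu>) = (\<integral>w. g w \<partial>\<nu>) + (\<integral>w. h w \<partial>\<nu>)"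
      by (intro Bochner_Integration.integral_add int continuous_coord_polys add.hyps)
    then show ?case using tendsto_add[OF add.IH] by (simp add: sum.distrib add_divide_distrib)
  qed
  show "regular_pt (hatD H) (hatH H) \<nu> z"
    unfolding regular_pt_def
  proof (intro conjI z allI impI)
    fix \<alpha> :: "(nat \<Rightarrow> complex) \<Rightarrow> real" assume \<alpha>: "continuous_on (hatD H) \<alpha>"
    let ?av = "\<lambda>g n. (\<Sum>i<n. g ((hatH H ^^ i) z)) / real n"
    show "?C \<alpha>"
    proof (rule LIMSEQ_I)
      fix r :: real assume r: "r > 0"
      obtain g where g: "g \<in> coord_polys" "\<And>w. w \<in> hatD H \<Longrightarrow> \<bar>\<alpha> w - g w\<bar> < r / 3"
        using coord_polys_dense[OF compact_hatD \<alpha>, of "r / 3"] r by auto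
      have ig: "integrable \<nu> g" by (intro int continuous_coord_polys g)
      have "\<bar>(\<integral>w. \<alpha> w \<partial>\<nu>) - (\<integral>w. g w \<partial>\<nu>)\<bar> = \<bar>\<integral>w. \<alpha> w - g w \<partial>\<nu>\<bar>"
        using int[OF \<alpha>] ig by simp
      also have "\<dots> \<le> (\<integral>w. \<bar>\<alpha> w - g w\<bar> \<partial>\<nu>)" by (rule integral_abs_bound)
      also have "\<dots> \<le> (\<integral>w. r / 3 \<partial>\<nu>)"
        using int[OF \<alpha>] ig g(2) \<nu>(1) by (intro integral_mono) (auto intro: less_imp_le)
      also have "\<dots> = r / 3" by (simp add: prob_space)
      finally have 1: "\<bar>(\<integral>w. \<alpha> w \<partial>\<nu>) - (\<integral>w. g w \<partial>\<nu>)\<bar> \<le> r / 3" .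
      have 2: "\<bar>?av \<alpha> n - ?av g n\<bar> \<le> r / 3" for n
      proof (cases "n = 0")
        case False
        have "\<bar>(\<Sum>i<n. \<alpha> ((hatH H ^^ i) z)) - (\<Sum>i<n. g ((hatH H ^^ i) z))\<bar> 
            \<le> (\<Sum>i<n. \<bar>\<alpha> ((hatH H ^^ i) z) - g ((hatH H ^^ i) z)\<bar>)"
          unfolding sum_subtractf[symmetric] by (rule sum_abs)
        also have "\<dots> \<le> (\<Sum>i<n. r / 3)"
          using g(2) hatH_pow_in[OF z] by (intro sum_mono less_imp_le) auto
        finally show ?thesis using False 
          by (simp add: diff_divide_distrib[symmetric] abs_divide pos_divide_le_eq mult.commute)
      qed (use r in simp)
      obtain n0 where n0: "\<And>n. n \<ge> n0 \<Longrightarrow> \<bar>?av g n - (\<integral>w. g w \<partial>\<nu>)\<bar> < r / 3"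
        using LIMSEQ_D[OF poly[OF g(1)], of "r / 3"] r by auto
      have "\<bar>?av \<alpha> n - (\<integral>w. \<alpha> w \<partial>\<nu>)\<bar> < r" if "n \<ge> n0" for n
        using 1 2[of n] n0[OF that] by linarith
      then show "\<exists>no. \<forall>n\<ge>no. norm (?av \<alpha> n - (\<integral>w. \<alpha> w \<partial>\<nu>)) < r" by auto
    qed
  qed
qed

end

section \<open>Generic points of the tent map and regular threads\<close>

locale unwrapping_measures = unwrapping Phi F t for Phi F t +
  fixes mu :: "real measure" and hmu :: "(nat \<Rightarrow> complex) measure"
  assumes acip: "is_acip t mu" and hat_mu: "is_hat_mu H mu hmu"
begin

lemma space_mu: "space mu = {-1..1}" and sets_mu: "sets mu = sets (restrict_space borel {-1..1})"
  using acip by (auto simp: is_acip_def)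

lemma space_hmu: "space hmu = hatD H" and sets_hmu: "sets hmu = sets (restrict_space borel (hatD H))"
  and measurable_hatH: "hatH H \<in> measurable hmu hmu"
  and distr_hmu: "distr hmu borel (\<lambda>z. z n) = distr mu borel complex_of_real"
  using hat_mu by (auto simp: is_hat_mu_def)

lemma sets_mu_iff: "A \<in> sets mu \<longleftrightarrow> A \<in> sets borel \<and> A \<subseteq> {-1..1}"
  unfolding sets_mu by (auto simp: sets_restrict_space_iff)

lemma mu_null:
  assumes "A \<in> sets mu" "negligible A"
  shows "emeasure mu A = 0"
proof -
  have A: "A \<in> sets borel" "A \<subseteq> {-1..1}" using assms sets_mu_iff by auto
  have "A \<in> null_sets lborel" using A assms(2) unfolding negligible_iff_null_sets by (auto simp: null_sets_def)
  then have "A \<in> null_sets (restrict_space lborel {-1..1})" using A by (subst null_sets_restrict_space) auto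
  then show ?thesis using acip by (auto simp: is_acip_def absolutely_continuous_def null_sets_def)
qed

lemma ergodic_mu: "ergodic_mpt mu (tent t)"
proof -
  interpret prob_space mu using acip by (simp add: is_acip_def)
  show ?thesis
  proof
    show "tent t \<in> measurable mu mu" "distr mu mu (tent t) = mu" using acip by (auto simp: is_acip_def)
    fix A assume A: "A \<in> sets mu" and inv: "\<And>x. x \<in> space mu \<Longrightarrow> tent t x \<in> A \<longleftrightarrow> x \<in> A"
    have "negligible A \<or> negligible ({-1..1} - A)"
      using A inv unfolding sets_mu_iff space_mu by (intro tent_ergodic_lebesgue[OF t_Jset]) auto
    then show "emeasure mu A = 0 \<or> emeasure mu (space mu - A) = 0"
      using mu_null A sets.compl_sets[OF A] by (auto simp: space_mu)
  qed
qed

lemma measurable_mu: "f \<in> borel_measurable borel \<Longrightarrow> f \<in> borel_measurable mu"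
  using measurable_restrict_space1[of f borel borel "{-1..1}"] measurable_cong_sets[OF sets_mu refl] by blast

lemma of_real_measurable_mu: "complex_of_real \<in> borel_measurable mu"
  by (intro measurable_mu borel_measurable_continuous_onI continuous_intros)

lemma proj_measurable_hmu: "(\<lambda>z. z n) \<in> borel_measurable hmu"
proof -
  have "(\<lambda>z::nat \<Rightarrow> complex. z n) \<in> borel_measurable borel"
    by (rule borel_measurable_continuous_onI) simp
  then show ?thesis
    using measurable_restrict_space1[of _ borel borel "hatD H"] measurable_cong_sets[OF sets_hmu refl] by blast
qed

text \<open>The total mass is read off the zeroth marginal, which is the image of
  \<open>mu\<close>.\<close>

lemma prob_space_hmu: "prob_space hmu"
proof -
  have "prob_space (distr hmu borel (\<lambda>z. z 0))"
    unfolding distr_hmu using acip of_real_measurable_mu 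
    by (intro prob_space.prob_space_distr) (auto simp: is_acip_def)
  then have "emeasure (distr hmu borel (\<lambda>z. z 0)) UNIV = 1"
    using prob_space.emeasure_space_1 by fastforce
  then have "emeasure hmu (space hmu) = 1"
    using emeasure_distr[OF proj_measurable_hmu[of 0], of UNIV] by simp
  then show ?thesis by (rule prob_spaceI)
qed

text \<open>On the orbit of a thread starting at x \<in> I, and on \<mu>-almost every thread, a monomial in the
  coordinates up to N is a function of the N-th coordinate alone.\<close>
definition reduced :: "(nat \<times> bool) list \<Rightarrow> real \<Rightarrow> real" where
  "reduced l x = indicator {-1..1} x * 
     coord_monomial l (\<lambda>n. complex_of_real ((tent t ^^ (sum_list (map fst l) - n)) x))"

text \<open>The sum of the indices is a crude common bound for them that also makes sense for the
  empty list.\<close>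

lemma index_le: "(n, b) \<in> set l \<Longrightarrow> n \<le> sum_list (map fst l)" for n :: nat
  using member_le_sum_list[of n "map fst l"] by force

lemma measurable_reduced: "reduced l \<in> borel_measurable borel"
  unfolding reduced_def[abs_def] using continuous_on_tent_iter
  by (intro borel_measurable_times borel_measurable_indicator borel_measurable_continuous_onI
      continuous_coord_monomial continuous_on_of_real) auto

lemma reduced_bound: "\<bar>reduced l x\<bar> \<le> 1"
proof (cases "x \<in> {-1..1}")
  case True
  have "norm (complex_of_real ((tent t ^^ n) x)) \<le> 1" for n
    using tent_iter_in_I[OF t_Jset True, of n] by (simp add: abs_le_iff)
  then show ?thesis using True by (simp add: reduced_def coord_monomial_le_1)
qed (simp add: reduced_def)

text \<open>On a thread the entries up to N are iterates of the N-th one, whose law under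
  \<open>hmu\<close> is \<open>mu\<close> carried to the real axis.\<close>

lemma integral_monomial: "(\<integral>w. coord_monomial l w \<partial>hmu) = (\<integral>x. reduced l x \<partial>mu)"
proof -
  define N where "N = sum_list (map fst l)"
  \<comment> \<open>The indicator extends the function to a Borel function on the plane, as
    \<open>H\<close> is known to be continuous only on D.\<close>
  define \<gamma> where "\<gamma> p = indicator Dset p *\<^sub>R coord_monomial l (\<lambda>n. (H ^^ (N - n)) p)" for p
  have \<gamma>: "\<gamma> \<in> borel_measurable borel"
    unfolding \<gamma>_def[abs_def]
    by (intro borel_measurable_continuous_on_indicator continuous_coord_monomial continuous_H_pow)
      (simp add: Dset_def)
  have "(\<integral>w. coord_monomial l w \<partial>hmu) = (\<integral>w. \<gamma> (w N) \<partial>hmu)"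
  proof (rule Bochner_Integration.integral_cong)
    fix w assume "w \<in> space hmu"
    then have w: "w \<in> hatD H" by (simp add: space_hmu)
    have "coord_monomial l w = coord_monomial l (\<lambda>n. (H ^^ (N - n)) (w N))"
    proof (rule coord_monomial_cong)
      fix n b assume "(n, b) \<in> set l"
      then have "n \<le> N" unfolding N_def by (rule index_le)
      then show "w n = (H ^^ (N - n)) (w N)" using hatD_pow[OF w, of "N - n" n] by simp
    qed
    then show "coord_monomial l w = \<gamma> (w N)" using hatD_in[OF w] by (simp add: \<gamma>_def)
  qed simp
  also have "\<dots> = (\<integral>p. \<gamma> p \<partial>distr hmu borel (\<lambda>w. w N))"
    by (rule integral_distr[symmetric, OF proj_measurable_hmu \<gamma>])
  also have "\<dots> = (\<integral>x. \<gamma> (complex_of_real x) \<partial>mu)"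
    unfolding distr_hmu by (rule integral_distr[OF of_real_measurable_mu \<gamma>])
  also have "\<dots> = (\<integral>x. reduced l x \<partial>mu)"
  proof (rule Bochner_Integration.integral_cong)
    fix x assume "x \<in> space mu"
    then have x: "x \<in> {-1..1}" by (simp add: space_mu)
    then have "complex_of_real x \<in> Dset" using Iset_subset_Dset by (auto simp: Iset_def)
    then show "\<gamma> (complex_of_real x) = reduced l x"
      using x H_pow_of_real[OF x] by (simp add: \<gamma>_def reduced_def N_def)
  qed simp
  finally show ?thesis .
qed

text \<open>After the additional N steps every entry that the monomial reads belongs to the forward
  orbit of x; at time i + N these are the iterates of order N - n of the i-th orbit point.\<close>

lemma monomial_hatH_pow:
  assumes z: "z 0 = complex_of_real x" and x: "x \<in> {-1..1}"
  shows "coord_monomial l ((hatH H ^^ (i + sum_list (map fst l))) z) = reduced l ((tent t ^^ i) x)"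
proof -
  let ?N = "sum_list (map fst l)"
  have "coord_monomial l ((hatH H ^^ (i + ?N)) z) = 
    coord_monomial l (\<lambda>n. complex_of_real ((tent t ^^ (?N - n)) ((tent t ^^ i) x)))"
  proof (rule coord_monomial_cong)
    fix n b assume "(n, b) \<in> set l"
    then have n: "n \<le> ?N" by (rule index_le)
    then have "(hatH H ^^ (i + ?N)) z n = (H ^^ (i + ?N - n)) (complex_of_real x)"
      using hatH_pow[of n "i + ?N" H z] z by simp
    also have "\<dots> = complex_of_real ((tent t ^^ (?N - n + i)) x)"
      using n H_pow_of_real[OF x] by (simp add: add.commute)
    finally show "(hatH H ^^ (i + ?N)) z n = complex_of_real ((tent t ^^ (?N - n)) ((tent t ^^ i) x))"
      by (simp add: funpow_add)
  qed
  then show ?thesis using tent_iter_in_I[OF t_Jset x, of i] by (simp add: reduced_def)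
qed

definition generic :: "real set" where
  "generic = {x \<in> space mu. \<forall>l. (\<lambda>n. birkhoff (tent t) (reduced l) n x / n) \<longlonglongrightarrow> (\<integral>x. reduced l x \<partial>mu)}"

lemma generic_sets: "generic \<in> sets mu" and generic_full: "emeasure mu generic = 1"
proof -
  interpret ergodic_mpt mu "tent t" by (rule ergodic_mu)
  have [measurable]: "birkhoff (tent t) (reduced l) n \<in> borel_measurable mu" for l n
    by (intro measurable_birkhoff measurable_mu measurable_reduced)
  show 1: "generic \<in> sets mu" unfolding generic_def by measurable
  have "AE x in mu. \<forall>l. (\<lambda>n. birkhoff (tent t) (reduced l) n x / n) \<longlonglongrightarrow> (\<integral>x. reduced l x \<partial>mu)"
    unfolding AE_all_countable using birkhoff_ergodic[OF measurable_mu[OF measurable_reduced] reduced_bound] by blast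
  then have "AE x in mu. x \<in> generic" using AE_space by eventually_elim (simp add: generic_def)
  then show "emeasure mu generic = 1" using emeasure_eq_1_AE[OF 1] by simp
qed

text \<open>Only the zeroth entry of the thread matters: the first N terms, which may still see the
  older entries, are removed by \<open>average_shift\<close>.\<close>

lemma regular_if_generic:
  assumes z: "z \<in> hatD H" "z 0 = complex_of_real x" and x: "x \<in> generic"
  shows "regular_pt (hatD H) (hatH H) hmu z"
proof -
  have xI: "x \<in> {-1..1}" using x by (simp add: generic_def space_mu)
  have "(\<lambda>n. (\<Sum>i<n. coord_monomial l ((hatH H ^^ i) z)) / real n) \<longlonglongrightarrow> (\<integral>w. coord_monomial l w \<partial>hmu)" for l
    unfolding integral_monomial
  proof (rule average_shift)
    have "(\<lambda>n. birkhoff (tent t) (reduced l) n x / n) \<longlonglongrightarrow> (\<integral>x. reduced l x \<partial>mu)"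
      using x by (simp add: generic_def)
    then show "(\<lambda>n. (\<Sum>i<n. coord_monomial l ((hatH H ^^ (i + sum_list (map fst l))) z)) / real n) 
        \<longlonglongrightarrow> (\<integral>x. reduced l x \<partial>mu)"
      by (simp only: monomial_hatH_pow[where z = z and x = x, OF z(2) xI] birkhoff_def)
  qed
  then show ?thesis using regular_pt_iff[OF prob_space_hmu space_hmu sets_hmu z(1)] by blast
qed

lemma regular_sets:
  "{z. regular_pt (hatD H) (hatH H) hmu z} \<in> sets (restrict_space borel (hatD H))"
proof -
  have "continuous_on UNIV (coord_monomial l)" for l
    using continuous_coord_polys[OF coord_polys.monomial[of 1 l]] by simp
  then have "coord_monomial l \<in> borel_measurable borel" for l
    by (rule borel_measurable_continuous_onI)
  then have [measurable]: "coord_monomial l \<in> borel_measurable hmu" for l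
    using measurable_restrict_space1[of _ borel borel "hatD H"] measurable_cong_sets[OF sets_hmu refl] by blast
  note [measurable] = measurable_hatH
  have "{z. regular_pt (hatD H) (hatH H) hmu z} = {z \<in> space hmu. \<forall>l.
    (\<lambda>n. (\<Sum>i<n. coord_monomial l ((hatH H ^^ i) z)) / real n) \<longlonglongrightarrow> (\<integral>w. coord_monomial l w \<partial>hmu)}"
    using regular_pt_iff[OF prob_space_hmu space_hmu sets_hmu] by (auto simp: space_hmu regular_pt_def)
  also have "\<dots> \<in> sets hmu" by measurable
  finally show ?thesis by (simp add: sets_hmu)
qed

text \<open>The cosine is differentiable, so it maps null sets to null sets. A null preimage in
  [0, pi] would make the generic set negligible and therefore \<open>mu\<close>-null, against its
  measure 1.\<close>

lemma cos_vimage_generic_pos: "emeasure lborel ({0..pi} \<inter> cos -` generic) > 0"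
proof (rule ccontr)
  let ?Y = "{0..pi} \<inter> cos -` generic"
  assume "\<not> ?thesis"
  moreover have Y: "?Y \<in> sets borel"
    using generic_sets unfolding sets_mu_iff
    by (intro sets.Int measurable_sets_borel[of cos] borel_measurable_continuous_onI continuous_intros) auto
  ultimately have "negligible ?Y" unfolding negligible_iff_null_sets by (auto simp: null_sets_def)
  moreover have "cos differentiable_on ?Y"
    unfolding differentiable_on_def real_differentiable_def
    using has_field_derivative_at_within[OF DERIV_cos] by blast
  ultimately have "negligible (cos ` ?Y)"
    by (intro negligible_differentiable_image_negligible) auto
  moreover have "generic \<subseteq> cos ` ?Y"
  proof
    fix x assume x: "x \<in> generic"
    then have "x \<in> {-1..1}" by (simp add: generic_def space_mu)
    then show "x \<in> cos ` ?Y" using x by (intro image_eqI[of _ _ "arccos x"]) (auto simp: arccos_lbound arccos_ubound)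
  qed
  ultimately have "negligible generic" by (rule negligible_subset)
  then have "emeasure mu generic = 0" using mu_null generic_sets by blast
  then show False using generic_full by simp
qed

theorem regular_positive: "emeasure (rho' Phi H) {z. regular_pt (hatD H) (hatH H) hmu z} > 0"
proof (rule rho'_pos[OF regular_sets])
  let ?Y = "{0..pi} \<inter> cos -` generic"
  have Y: "?Y \<in> sets borel"
    using generic_sets unfolding sets_mu_iff
    by (intro sets.Int measurable_sets_borel[of cos] borel_measurable_continuous_onI continuous_intros) auto
  \<comment> \<open>For these s the first entry has level s / 2 in [1/2, 3/4]. There the unwrapping
    is the identity and the level doubles past 1, so the zeroth entry is exactly cos y.\<close>
  show "?Y \<times> {1..3/2::real} \<subseteq> Psi Phi H -` {z. regular_pt (hatD H) (hatH H) hmu z} \<inter> Aset"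
  proof
    fix a assume "a \<in> ?Y \<times> {1..3/2::real}"
    then obtain y s where a: "a = (y, s)" "0 \<le> y" "y \<le> pi" "cos y \<in> generic" and s: "1 \<le> s" "s \<le> 3/2"
      by auto
    have s1: "s \<in> {real 1..<real 1 + 1}" using s by auto
    have "Psi Phi H (y, s) 0 = H (Phi y (fund_lev 1 s))"
      using hatD_step[OF Psi_in_hatD[OF s1], of y 0] Psi_at[OF s1, of y] by simp
    also have "\<dots> = complex_of_real (cos y)"
      using H_Phi[of "s / 2" y] s by (simp add: fund_lev_def Phi_1)
    finally have "regular_pt (hatD H) (hatH H) hmu (Psi Phi H (y, s))"
      using a(4) by (intro regular_if_generic[OF Psi_in_hatD[OF s1]])
    moreover from a(3) pi_gt_zero have "y < 2 * pi" by linarith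
    then have "a \<in> Aset" using a s by (simp add: Aset_def)
    ultimately show "a \<in> Psi Phi H -` {z. regular_pt (hatD H) (hatH H) hmu z} \<inter> Aset" by (simp add: a)
  qed
  show "?Y \<times> {1..3/2::real} \<in> sets borel"
    unfolding borel_prod[symmetric] using Y by (intro pair_measureI) auto
  show "emeasure lborel (?Y \<times> {1..3/2::real}) > 0"
  proof -
    have "emeasure lborel {1..3/2::real} > 0"
      by (subst emeasure_lborel_Icc) (simp, rule ennreal_less_zero_iff[THEN iffD2], simp)
    then show ?thesis
      using cos_vimage_generic_pos Y
      by (subst emeasure_lborel_Times_real) (simp_all only: ennreal_zero_less_mult_iff simp_thms borel_closed closed_atLeastAtMost)
  qed
qed

end

theorem mainTheorem8:
  fixes Phi :: "real \<Rightarrow> real \<Rightarrow> complex"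
    and fb :: "real \<Rightarrow> complex \<Rightarrow> complex"
    and t :: real
    and mu :: "real measure"
    and hmu :: "(nat \<Rightarrow> complex) measure"
  assumes coords: "is_cyl_coords Phi"
    and unwrap: "is_unwrapping Phi fb"
    and tJ: "t \<in> Jset"
    and acip: "is_acip t mu"
    and hatmu: "is_hat_mu (\<lambda>p. Ups Phi (fb t p)) mu hmu"
  shows "oxtoby_ulam (hatD (\<lambda>p. Ups Phi (fb t p))) (rho' Phi (\<lambda>p. Ups Phi (fb t p)))
       \<and> emeasure (rho' Phi (\<lambda>p. Ups Phi (fb t p)))
           {x. regular_pt (hatD (\<lambda>p. Ups Phi (fb t p))) (hatH (\<lambda>p. Ups Phi (fb t p))) hmu x} > 0"
proof -
  have "continuous_on ({t} \<times> Dset) (\<lambda>(t, p). fb t p)"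
    using unwrap tJ by (auto simp: is_unwrapping_def intro: continuous_on_subset)
  then have "continuous_on Dset (\<lambda>p. (\<lambda>(t, p). fb t p) (t, p))"
    by (rule continuous_on_compose2) (auto intro!: continuous_intros)
  then have cont: "continuous_on Dset (fb t)" by simp
  interpret unwrapping Phi "fb t" t
    by unfold_locales (use cont coords unwrap tJ in \<open>auto simp: is_unwrapping_def\<close>)
  have H: "H = (\<lambda>p. Ups Phi (fb t p))" by (simp add: H_def fun_eq_iff)
  interpret unwrapping_measures Phi "fb t" t mu hmu
    by unfold_locales (use acip hatmu H in auto)
  show ?thesis using oxtoby_ulam_rho' regular_positive unfolding H by blast
qed

end
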